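(* Let $G=\{g_1:=0,g_2,\ldots,g_n\}$ be a finite (additively written) Abelian group of order $n\ge 2$, and let $$L_G=\Big\{{\boldsymbol x}=(x_1,\ldots,x_n)\in\mathbb{Z}^n:\ \sum_{i=1}^n x_i=0,\ \sum_{j=2}^n x_j g_j=0\Big\}.$$ Then $L_G$ is strongly eutactic in $\operatorname{span}_{\mathbb R} L_G$ if and only if $G$ has odd order or $G$ is isomorphic to $(\mathbb{Z}/2\mathbb{Z})^\nu$ for some $\nu\ge 1$.
   Context: For a lattice $\Lambda\subset\mathbb{R}^N$ let $|\Lambda|=\min\{\|{\boldsymbol x}\|:{\boldsymbol x}\in\Lambda\setminus\{0\}\}$ (Euclidean norm) and $S(\Lambda)=\{{\boldsymbol x}\in\Lambda:\|{\boldsymbol x}\|=|\Lambda|\}$ its set of minimal vectors. A finite set ${\boldsymbol y}_1,\dots,{\boldsymbol y}_m$ on the unit sphere of a real Euclidean space $V$ is a spherical $2$-design if for every real polynomial $f$ of degree $\le 2$ on $V$, the average of $f$ over the unit sphere of $V$ (with respect to the normalized surface measure) equals $\frac1m\sum_{i=1}^m f({\boldsymbol y}_i)$. A lattice $\Lambda$ is strongly eutactic (in $V=\operatorname{span}_{\mathbb R}\Lambda$) if the set $\frac{1}{|\Lambda|}S(\Lambda)$ is a spherical $2$-design in $V$; equivalently, $\sum_{{\boldsymbol x}\in S(\Lambda)}({\boldsymbol x},{\boldsymbol y})^2=\frac{|\Lambda|^2|S(\Lambda)|}{\dim V}({\boldsymbol y},{\boldsymbol y})$ for all ${\boldsymbol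 y}\in V$. *)

theory Defs
  imports "HOL-Analysis.Analysis" "HOL-Algebra.FiniteProduct" "HOL-Algebra.Product_Groups"
begin

definition orthonormal_basis_of :: "'v::euclidean_space set \<Rightarrow> 'v set \<Rightarrow> bool" where
  "orthonormal_basis_of B V \<longleftrightarrow>
     pairwise orthogonal B \<and> (\<forall>b\<in>B. norm b = 1) \<and> span B = V"

text \<open>
  Lebesgue measure on a linear subspace \<open>V\<close>, regarded as a Borel measure on the ambient space that
  is carried by \<open>V\<close>. As for \<^const>\<open>lborel\<close>, it is the image of the product measure under the
  coordinates of an orthonormal basis; by rotation invariance the choice of basis is immaterial.
\<close>

definition subspace_lborel :: "'v::euclidean_space set \<Rightarrow> 'v measure" where
  "subspace_lborel V =
     (let B = (SOME B. orthonormal_basis_of B V)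
      in distr (\<Pi>\<^sub>M b\<in>B. lborel) borel (\<lambda>f. \<Sum>b\<in>B. f b *\<^sub>R b))"

text \<open>
  The normalised surface measure on the unit sphere of \<open>V\<close> is the cone measure: the measure of
  \<open>A\<close> is the proportion of the unit ball of \<open>V\<close> that is occupied by the cone over \<open>A\<close>. In dimension
  one it gives mass 1/2 to each of the two unit vectors.
\<close>

definition sphere_measure :: "'v::euclidean_space set \<Rightarrow> 'v measure" where
  "sphere_measure V =
     distr (uniform_measure (subspace_lborel V) (cball 0 1)) borel (\<lambda>x. x /\<^sub>R norm x)"

text \<open>
  \<open>real_polynomial_deg_le k f\<close>: the function \<open>f\<close> is a real polynomial of degree at most \<open>k\<close>;
  this is \<^const>\<open>real_polynomial_function\<close> with a bound on the degree.
\<close>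

inductive real_polynomial_deg_le :: "nat \<Rightarrow> ('v::real_normed_vector \<Rightarrow> real) \<Rightarrow> bool" where
  const: "real_polynomial_deg_le k (\<lambda>x. c)"
| linear: "bounded_linear f \<Longrightarrow> real_polynomial_deg_le (Suc k) f"
| add: "real_polynomial_deg_le k f \<Longrightarrow> real_polynomial_deg_le k g \<Longrightarrow>
          real_polynomial_deg_le k (\<lambda>x. f x + g x)"
| mult: "real_polynomial_deg_le k f \<Longrightarrow> real_polynomial_deg_le l g \<Longrightarrow>
          real_polynomial_deg_le (k + l) (\<lambda>x. f x * g x)"

text \<open>
  The polynomials below are functions on the ambient space; their restrictions to \<open>V\<close> are exactly
  the polynomials on \<open>V\<close>, and only their values on \<open>V\<close> matter.
\<close>

definition spherical_design :: "nat \<Rightarrow> 'v::euclidean_space set \<Rightarrow> 'v set \<Rightarrow> bool" where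
  "spherical_design t V Y \<longleftrightarrow>
     finite Y \<and> Y \<noteq> {} \<and> Y \<subseteq> V \<inter> sphere 0 1 \<and>
     (\<forall>f. real_polynomial_deg_le t f \<longrightarrow>
        (\<integral>x. f x \<partial>sphere_measure V) = (1 / real (card Y)) * (\<Sum>y\<in>Y. f y))"

definition lattice_min :: "'v::euclidean_space set \<Rightarrow> real" where
  "lattice_min L = (LEAST r. r \<in> norm ` (L - {0}))"

definition min_vectors :: "'v::euclidean_space set \<Rightarrow> 'v set" where
  "min_vectors L = {x \<in> L. norm x = lattice_min L}"

definition strongly_eutactic :: "'v::euclidean_space set \<Rightarrow> bool" where
  "strongly_eutactic L \<longleftrightarrow>
     spherical_design 2 (span L) ((\<lambda>x. x /\<^sub>R lattice_min L) ` min_vectors L)"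

text \<open>
  The group is written multiplicatively, as in HOL-Algebra. The index type \<open>'n\<close> plays the role of
  \<open>{1, \<dots>, n}\<close>, \<open>g\<close> enumerates the group, and \<open>o1\<close> stands for the index 1 of the neutral element.
\<close>

definition group_lattice :: "('a, 'c) monoid_scheme \<Rightarrow> ('n::finite \<Rightarrow> 'a) \<Rightarrow> 'n \<Rightarrow> (real ^ 'n) set" where
  "group_lattice G g o1 =
     {(\<chi> i. real_of_int (x i)) | x :: 'n \<Rightarrow> int.
        (\<Sum>i\<in>UNIV. x i) = 0 \<and>
        (\<Otimes>\<^bsub>G\<^esub>j\<in>UNIV - {o1}. g j [^]\<^bsub>G\<^esub> x j) = \<one>\<^bsub>G\<^esub>}"

end

theory Submission
  imports Defs "HOL-Probability.Probability_Measure" "HOL-Algebra.Sylow"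
    "HOL-Algebra.Multiplicative_Group"
begin

text \<open>
  By the symmetry of the sphere measure under signed permutations of an orthonormal basis, an
  antipodal set \<open>Y\<close> is a 2-design iff the quadratic form \<open>\<Sum>y\<in>Y. (y \<bullet> z)\<^sup>2\<close> is a multiple of \<open>z \<bullet> z\<close>.
  For the lattice of \<open>G\<close>, translations of \<open>G\<close> permute the minimal vectors, so the matrix of this form
  is \<open>M i j = F (g i - g j)\<close>, and on the hyperplane of coordinate sum zero the condition says that \<open>F\<close>
  is constant on nonzero elements. This is automatic for \<open>n \<le> 3\<close>. For \<open>n \<ge> 4\<close> the minimal vectors
  are the \<open>e\<^sub>a + e\<^sub>b - e\<^sub>c - e\<^sub>d\<close> with distinct indices and \<open>g a + g b = g c + g d\<close>, and counting gives
  \<open>F d = 4 - n - (r d + (if 2 d = 0 then 2 else 0))\<close>, where \<open>r d\<close> is the number of \<open>c\<close> with \<open>2 c = d\<close>.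
  If \<open>F\<close> is constant, \<open>n\<close> is even and \<open>2 u \<noteq> 0\<close> for some \<open>u\<close>, take \<open>d\<close> of order 2: comparing with
  \<open>F d\<close> shows that \<open>u\<close> and \<open>u + d\<close> are both doubles, hence so is \<open>d\<close>; but then \<open>r d = r u\<close>, and
  \<open>F d \<noteq> F u\<close>.
\<close>

section \<open>Designs of strength two\<close>

lemma orthonormal_basis_of_finite:
  assumes "orthonormal_basis_of B V"
  shows "finite B"
  using assms pairwise_orthogonal_imp_finite by (auto simp: orthonormal_basis_of_def)

lemma orthonormal_basis_of_inner:
  assumes "orthonormal_basis_of B V" "b \<in> B" "c \<in> B"
  shows "b \<bullet> c = (if b = c then 1 else 0)"
  using assms by (auto simp: orthonormal_basis_of_def pairwise_def orthogonal_def norm_eq_1)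

lemma orthonormal_basis_of_expansion:
  assumes B: "orthonormal_basis_of B V" and x: "x \<in> V"
  shows "x = (\<Sum>b\<in>B. (x \<bullet> b) *\<^sub>R b)"
proof -
  have fB: "finite B" using B by (rule orthonormal_basis_of_finite)
  have "x \<in> span B" using B x by (simp add: orthonormal_basis_of_def)
  then obtain u where u: "x = (\<Sum>b\<in>B. u b *\<^sub>R b)"
    using span_finite[OF fB] by auto
  have "x \<bullet> b = u b" if "b \<in> B" for b
  proof -
    have "x \<bullet> b = (\<Sum>c\<in>B. u c * (c \<bullet> b))"
      by (simp add: u inner_sum_left)
    also have "\<dots> = (\<Sum>c\<in>B. if c = b then u b else 0)"
      by (rule sum.cong) (auto simp: orthonormal_basis_of_inner[OF B _ that])
    finally show ?thesis using that fB by simp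
  qed
  then show ?thesis using u by simp
qed

lemma orthonormal_basis_of_combination_inner:
  assumes "orthonormal_basis_of B V" "b \<in> B"
  shows "(\<Sum>c\<in>B. f c *\<^sub>R c) \<bullet> b = f b"
proof -
  have "(\<Sum>c\<in>B. f c *\<^sub>R c) \<bullet> b = (\<Sum>c\<in>B. if c = b then f b else 0)"
    unfolding inner_sum_left
    by (rule sum.cong) (auto simp: orthonormal_basis_of_inner[OF assms(1) _ assms(2)])
  then show ?thesis using assms(2) orthonormal_basis_of_finite[OF assms(1)] by simp
qed

lemma orthonormal_basis_of_norm_sq:
  assumes B: "orthonormal_basis_of B V" and x: "x \<in> V"
  shows "x \<bullet> x = (\<Sum>b\<in>B. (x \<bullet> b)\<^sup>2)"
proof -
  have "x \<bullet> x = x \<bullet> (\<Sum>b\<in>B. (x \<bullet> b) *\<^sub>R b)"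
    using orthonormal_basis_of_expansion[OF B x] by simp
  then show ?thesis by (simp add: inner_sum_right power2_eq_square)
qed

lemma orthonormal_basis_of_quadratic_form:
  assumes B: "orthonormal_basis_of B V" and x: "x \<in> V" and A: "linear A"
  shows "x \<bullet> A x = (\<Sum>b\<in>B. \<Sum>d\<in>B. (b \<bullet> A d) * ((x \<bullet> b) * (x \<bullet> d)))"
proof -
  have "x \<bullet> A x = (\<Sum>b\<in>B. (x \<bullet> b) *\<^sub>R b) \<bullet> A (\<Sum>d\<in>B. (x \<bullet> d) *\<^sub>R d)"
    using orthonormal_basis_of_expansion[OF B x] by simp
  also have "\<dots> = (\<Sum>b\<in>B. \<Sum>d\<in>B. (d \<bullet> A b) * ((x \<bullet> d) * (x \<bullet> b)))"
    by (simp add: linear_sum[OF A] linear_scale[OF A] inner_sum_left inner_sum_right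
        sum_distrib_left mult_ac)
  also have "\<dots> = (\<Sum>b\<in>B. \<Sum>d\<in>B. (b \<bullet> A d) * ((x \<bullet> b) * (x \<bullet> d)))"
    by (rule sum.swap)
  finally show ?thesis .
qed

lemma orthonormal_basis_of_exists:
  assumes "subspace V"
  obtains B where "orthonormal_basis_of B V"
  using orthonormal_basis_subspace[OF assms] unfolding orthonormal_basis_of_def by metis

section \<open>Normal form of polynomials of degree at most two\<close>

text \<open>The vanishing clauses for the bounds 1 and 0 strengthen the induction: when two factors
  with \<open>k + l \<le> 2\<close> are multiplied, they force every cubic and quartic cross term to
  be zero, so that the product stays quadratic.\<close>

lemma real_polynomial_deg_le_2_quadratic:
  assumes "real_polynomial_deg_le k f" "k \<le> 2"
  shows "\<exists>c a A. linear A \<and> (k \<le> 1 \<longrightarrow> A = (\<lambda>x. 0)) \<and> (k = 0 \<longrightarrow> a = 0) \<and>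
           f = (\<lambda>x::'v::euclidean_space. c + a \<bullet> x + x \<bullet> A x)"
  using assms
proof (induction rule: real_polynomial_deg_le.induct)
  case (const k c)
  show ?case by (intro exI[of _ c] exI[of _ 0] exI[of _ "\<lambda>x. 0"]) (auto intro: linear_zero)
next
  case (linear f k)
  then have "linear f" by (simp add: bounded_linear.linear)
  have "f = (\<lambda>x. 0 + (\<Sum>b\<in>Basis. f b *\<^sub>R b) \<bullet> x + x \<bullet> 0)"
  proof
    fix x
    have "f x = f (\<Sum>b\<in>Basis. (x \<bullet> b) *\<^sub>R b)" by (simp add: euclidean_representation)
    also have "\<dots> = (\<Sum>b\<in>Basis. f b *\<^sub>R b) \<bullet> x"
      by (simp add: linear_sum[OF \<open>linear f\<close>] linear_scale[OF \<open>linear f\<close>] inner_sum_left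
          inner_commute[of x] mult.commute)
    finally show "f x = 0 + (\<Sum>b\<in>Basis. f b *\<^sub>R b) \<bullet> x + x \<bullet> 0" by simp
  qed
  then show ?case
    by (intro exI[of _ 0] exI[of _ "\<Sum>b\<in>Basis. f b *\<^sub>R b"] exI[of _ "\<lambda>x. 0"]) (auto intro: linear_zero)
next
  case (add k f g)
  from add.IH(1)[OF add.prems] add.IH(2)[OF add.prems] obtain c a A c' a' A' where
    "linear A" "k \<le> 1 \<longrightarrow> A = (\<lambda>x. 0)" "k = 0 \<longrightarrow> a = 0" "f = (\<lambda>x. c + a \<bullet> x + x \<bullet> A x)"
    and "linear A'" "k \<le> 1 \<longrightarrow> A' = (\<lambda>x. 0)" "k = 0 \<longrightarrow> a' = 0" "g = (\<lambda>x. c' + a' \<bullet> x + x \<bullet> A' x)"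
    by (elim exE conjE)
  then show ?case
    by (intro exI[of _ "c + c'"] exI[of _ "a + a'"] exI[of _ "\<lambda>x. A x + A' x"])
       (auto intro: linear_compose_add simp: algebra_simps)
next
  case (mult k f l g)
  then have "k \<le> 2" "l \<le> 2" by auto
  from mult.IH(1)[OF this(1)] mult.IH(2)[OF this(2)] obtain c a A c' a' A' where
    *: "linear A" "k \<le> 1 \<longrightarrow> A = (\<lambda>x. 0)" "k = 0 \<longrightarrow> a = 0" "f = (\<lambda>x. c + a \<bullet> x + x \<bullet> A x)"
    and **: "linear A'" "l \<le> 1 \<longrightarrow> A' = (\<lambda>x. 0)" "l = 0 \<longrightarrow> a' = 0" "g = (\<lambda>x. c' + a' \<bullet> x + x \<bullet> A' x)"
    by (elim exE conjE)
  \<comment> \<open>The product of the two linear parts equals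
    \<open>x \<bullet> ((a' \<bullet> x) *\<^sub>R a)\<close>, a quadratic form given by a linear
    operator. The other two terms of \<open>D\<close> come from constant times quadratic.\<close>
  define D where "D = (\<lambda>x. c *\<^sub>R A' x + c' *\<^sub>R A x + (a' \<bullet> x) *\<^sub>R a)"
  have "linear D" unfolding D_def
    using *(1) **(1) by (auto simp: linear_iff algebra_simps)
  moreover have "(\<lambda>x. f x * g x) = (\<lambda>x. c * c' + (c *\<^sub>R a' + c' *\<^sub>R a) \<bullet> x + x \<bullet> D x)"
  proof
    fix x
    have zeros: "(a \<bullet> x) * (x \<bullet> A' x) = 0" "(x \<bullet> A x) * (a' \<bullet> x) = 0" "(x \<bullet> A x) * (x \<bullet> A' x) = 0"
      using * ** mult.prems by (cases k; cases l; force)+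
    have "f x * g x = c * c' + (c *\<^sub>R a' + c' *\<^sub>R a) \<bullet> x + x \<bullet> D x
        + ((a \<bullet> x) * (x \<bullet> A' x) + (x \<bullet> A x) * (a' \<bullet> x) + (x \<bullet> A x) * (x \<bullet> A' x))"
      by (simp add: *(4) **(4) D_def algebra_simps inner_commute)
    then show "f x * g x = c * c' + (c *\<^sub>R a' + c' *\<^sub>R a) \<bullet> x + x \<bullet> D x"
      unfolding zeros by simp
  qed
  moreover have "D = (\<lambda>x. 0)" if "k + l \<le> 1"
    using that * ** by (cases k; cases l) (auto simp: D_def)
  moreover have "c *\<^sub>R a' + c' *\<^sub>R a = 0" if "k + l = 0"
    using that * ** by auto
  ultimately show ?case
    by (intro exI[of _ "c * c'"] exI[of _ "c *\<^sub>R a' + c' *\<^sub>R a"] exI[of _ D]) blast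
qed

lemma real_polynomial_deg_le_inner_square:
  "real_polynomial_deg_le 2 (\<lambda>x::'v::euclidean_space. (x \<bullet> z)\<^sup>2)"
proof -
  have "real_polynomial_deg_le (Suc 0) (\<lambda>x. x \<bullet> z)"
    by (rule real_polynomial_deg_le.linear) (rule bounded_linear_inner_left)
  from real_polynomial_deg_le.mult[OF this this] show ?thesis
    by (simp add: power2_eq_square numeral_2_eq_2)
qed

section \<open>Signed permutations and product Lebesgue measure\<close>

text \<open>Restricting to \<open>I\<close> keeps the result extensional, as points of the product
  space must be.\<close>

definition signed_permute :: "'i set \<Rightarrow> ('i \<Rightarrow> real) \<Rightarrow> ('i \<Rightarrow> 'i) \<Rightarrow> ('i \<Rightarrow> real) \<Rightarrow> 'i \<Rightarrow> real" where
  "signed_permute I s p f = (\<lambda>i\<in>I. s i * f (p i))"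

lemma emeasure_lborel_sign:
  assumes "s = 1 \<or> s = (-1::real)" "A \<in> sets borel"
  shows "emeasure lborel ((*) s -` A) = emeasure lborel A"
proof -
  have "distr lborel borel ((*) s) = lborel"
    using assms(1) lborel_distr_uminus by (auto simp: distr_id lborel_def distr_distr cong: distr_cong)
  then have "emeasure lborel A = emeasure (distr lborel borel ((*) s)) A" by simp
  also have "\<dots> = emeasure lborel ((*) s -` A)"
    using assms(2) by (subst emeasure_distr) auto
  finally show ?thesis ..
qed

lemma signed_permute_measurable:
  assumes "p permutes I"
  shows "signed_permute I s p \<in> (\<Pi>\<^sub>M i\<in>I. lborel) \<rightarrow>\<^sub>M (\<Pi>\<^sub>M i\<in>I. lborel)"
proof -
  have "(\<lambda>f. s i * f (p i)) \<in> (\<Pi>\<^sub>M i\<in>I. lborel) \<rightarrow>\<^sub>M lborel" if "i \<in> I" for i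
    using permutes_in_image[OF assms] that
    by (auto intro!: borel_measurable_times measurable_component_singleton
        simp: measurable_lborel1)
  then show ?thesis
    unfolding signed_permute_def[abs_def] by (rule measurable_restrict)
qed

text \<open>The preimage of a box is again a box, with its sides permuted and possibly reflected.
  Reflection preserves the length of a side, the permutation only reorders the factors, and boxes
  determine the product measure.\<close>

lemma distr_signed_permute:
  fixes s :: "'i \<Rightarrow> real"
  assumes I: "finite I" and p: "p permutes I" and s: "\<And>i. i \<in> I \<Longrightarrow> s i = 1 \<or> s i = -1"
  shows "distr (\<Pi>\<^sub>M i\<in>I. lborel) (\<Pi>\<^sub>M i\<in>I. lborel) (signed_permute I s p) = (\<Pi>\<^sub>M i\<in>I. lborel)"
    (is "distr ?P ?P ?U = ?P")
proof -
  interpret product_sigma_finite "\<lambda>i::'i. lborel :: real measure"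
    by standard
  show ?thesis
  proof (rule PiM_eqI[OF I])
    fix A :: "'i \<Rightarrow> real set"
    assume A: "\<And>i. i \<in> I \<Longrightarrow> A i \<in> sets lborel"
    define q where "q = inv_into UNIV p"
    have pq: "p (q i) = i" "q (p i) = i" for i
      using permutes_inverses[OF p] by (auto simp: q_def)
    have qI: "q permutes I" using p by (simp add: q_def permutes_inv)
    have iI: "p i \<in> I \<longleftrightarrow> i \<in> I" "q i \<in> I \<longleftrightarrow> i \<in> I" for i
      using permutes_in_image[OF p] permutes_in_image[OF qI] by auto
    have vim: "?U -` Pi\<^sub>E I A \<inter> space ?P = Pi\<^sub>E I (\<lambda>j. (*) (s (q j)) -` A (q j))"
    proof (intro equalityI subsetI)
      fix f assume f: "f \<in> ?U -` Pi\<^sub>E I A \<inter> space ?P"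
      then have "s i * f (p i) \<in> A i" if "i \<in> I" for i
        using that by (auto simp: signed_permute_def PiE_iff)
      from this[of "q _"] have "s (q j) * f j \<in> A (q j)" if "j \<in> I" for j
        using that by (simp add: iI pq)
      with f show "f \<in> Pi\<^sub>E I (\<lambda>j. (*) (s (q j)) -` A (q j))"
        by (auto simp: space_PiM PiE_iff)
    next
      fix f assume f: "f \<in> Pi\<^sub>E I (\<lambda>j. (*) (s (q j)) -` A (q j))"
      then have "s (q j) * f j \<in> A (q j)" if "j \<in> I" for j
        using that by auto
      from this[of "p _"] have "s i * f (p i) \<in> A i" if "i \<in> I" for i
        using that by (simp add: iI pq)
      with f show "f \<in> ?U -` Pi\<^sub>E I A \<inter> space ?P"
        by (auto simp: space_PiM PiE_iff signed_permute_def)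
    qed
    have "emeasure (distr ?P ?P ?U) (Pi\<^sub>E I A) = emeasure ?P (Pi\<^sub>E I (\<lambda>j. (*) (s (q j)) -` A (q j)))"
      using A I by (subst emeasure_distr) (auto intro!: signed_permute_measurable p sets_PiM_I_finite simp: vim)
    also have "\<dots> = (\<Prod>j\<in>I. emeasure lborel ((*) (s (q j)) -` A (q j)))"
    proof (rule emeasure_PiM[OF I])
      fix j assume "j \<in> I"
      then have "A (q j) \<in> sets borel" using A iI by auto
      then have "(*) (s (q j)) -` A (q j) \<inter> space borel \<in> sets borel"
        by (intro measurable_sets[of _ borel borel]) auto
      then show "(*) (s (q j)) -` A (q j) \<in> sets lborel" by simp
    qed
    also have "\<dots> = (\<Prod>j\<in>I. emeasure lborel (A (q j)))"
      by (rule prod.cong[OF refl], rule emeasure_lborel_sign) (use s A iI in auto)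
    also have "\<dots> = (\<Prod>i\<in>I. emeasure lborel (A i))"
      using prod.permute[OF qI, of "\<lambda>i. emeasure lborel (A i)"] by (simp add: o_def)
    finally show "emeasure (distr ?P ?P ?U) (Pi\<^sub>E I A) = (\<Prod>i\<in>I. emeasure lborel (A i))" .
  qed simp
qed

section \<open>First and second moments of the sphere measure\<close>

text \<open>The assumption \<open>chosen\<close> ties \<open>B\<close> to the basis selected inside
  \<open>subspace_lborel\<close>. The sphere measure can then be computed in the coordinates of this
  very basis, with no appeal to rotation invariance.\<close>

locale sphere_coordinates =
  fixes V B :: "'v::euclidean_space set"
  assumes subspace: "subspace V"
    and basis: "orthonormal_basis_of B V"
    and nonempty: "B \<noteq> {}"
    and chosen: "B = (SOME B. orthonormal_basis_of B V)"
begin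

definition "coords = (\<Pi>\<^sub>M b\<in>B. (lborel :: real measure))"
definition "point f = (\<Sum>b\<in>B. f b *\<^sub>R b)"
definition "solid = {f \<in> space coords. norm (point f) \<le> 1}"
definition "ball_measure = uniform_measure coords solid"
text \<open>At the origin the convention \<open>inverse 0 = 0\<close> gives the value 0, which is
  off the sphere; \<open>AE_direction_norm\<close> shows that this affects a null set only.\<close>

definition "direction f = point f /\<^sub>R norm (point f)"

lemma finite_B: "finite B"
  using basis by (rule orthonormal_basis_of_finite)

lemma point_measurable [measurable]: "point \<in> borel_measurable coords"
proof -
  have "(\<lambda>f. f b *\<^sub>R b) \<in> borel_measurable coords" if "b \<in> B" for b
    using that unfolding coords_def
    by (intro borel_measurable_scaleR) (auto intro: measurable_component_singleton simp flip: measurable_lborel1)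
  then show ?thesis unfolding point_def[abs_def] by (rule borel_measurable_sum)
qed

lemma direction_measurable [measurable]: "direction \<in> borel_measurable coords"
  unfolding direction_def[abs_def] by measurable

lemma solid_measurable [measurable]: "solid \<in> sets coords"
  unfolding solid_def by measurable

lemma point_inner: "b \<in> B \<Longrightarrow> point f \<bullet> b = f b"
  unfolding point_def by (rule orthonormal_basis_of_combination_inner[OF basis])

lemma point_in: "point f \<in> V"
  using basis unfolding point_def orthonormal_basis_of_def
  by (auto intro: span_sum span_scale span_base)

lemma direction_in: "direction f \<in> V"
  unfolding direction_def using subspace point_in by (rule subspace_scale)

lemma norm_point: "(norm (point f))\<^sup>2 = (\<Sum>b\<in>B. (f b)\<^sup>2)"
  using orthonormal_basis_of_norm_sq[OF basis point_in, of f]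
  by (simp add: power2_norm_eq_inner point_inner)

lemma emeasure_cube:
  assumes "r \<ge> 0"
  shows "emeasure coords (Pi\<^sub>E B (\<lambda>b. {-r..r})) = ennreal (2 * r) ^ card B"
proof -
  interpret product_sigma_finite "\<lambda>b::'v. lborel :: real measure"
    by standard
  show ?thesis unfolding coords_def
    using assms by (subst emeasure_PiM[OF finite_B]) auto
qed

lemma solid_subset_cube: "solid \<subseteq> Pi\<^sub>E B (\<lambda>b. {-1..1})"
proof
  fix f assume f: "f \<in> solid"
  have "\<bar>f b\<bar> \<le> 1" if "b \<in> B" for b
  proof -
    have "norm b = 1" using basis that by (simp add: orthonormal_basis_of_def)
    then have "\<bar>f b\<bar> \<le> norm (point f)"
      using Cauchy_Schwarz_ineq2[of "point f" b] that by (simp add: point_inner)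
    then show ?thesis using f by (simp add: solid_def)
  qed
  then show "f \<in> Pi\<^sub>E B (\<lambda>b. {-1..1})"
    using f by (auto simp: solid_def coords_def space_PiM PiE_iff abs_le_iff minus_le_iff)
qed

lemma cube_subset_solid: "Pi\<^sub>E B (\<lambda>b. {-1 / card B..1 / card B}) \<subseteq> solid"
proof
  fix f :: "'v \<Rightarrow> real" assume f: "f \<in> Pi\<^sub>E B (\<lambda>b. {-1 / card B..1 / card B})"
  have "norm (point f) \<le> (\<Sum>b\<in>B. norm (f b *\<^sub>R b))"
    unfolding point_def by (rule norm_sum)
  also have "\<dots> \<le> (\<Sum>b\<in>B. 1 / card B)"
  proof (rule sum_mono)
    fix b assume b: "b \<in> B"
    then have "norm b = 1" using basis by (simp add: orthonormal_basis_of_def)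
    moreover have "f b \<in> {-1 / card B..1 / card B}" using f b by auto
    ultimately show "norm (f b *\<^sub>R b) \<le> 1 / card B" by (auto simp: abs_le_iff)
  qed
  also have "\<dots> \<le> 1" using nonempty finite_B by simp
  finally show "f \<in> solid"
    using f by (auto simp: solid_def coords_def space_PiM PiE_iff)
qed

text \<open>The ball lies between the cubes of half side \<open>1 / card B\<close> (triangle
  inequality) and 1 (Cauchy-Schwarz). Positive finite volume is what makes the uniform measure a
  probability measure.\<close>

lemma emeasure_solid: "emeasure coords solid \<noteq> 0" "emeasure coords solid \<noteq> \<infinity>"
proof -
  have "emeasure coords solid \<le> emeasure coords (Pi\<^sub>E B (\<lambda>b. {-1..1}))"
    by (rule emeasure_mono[OF solid_subset_cube])
       (auto simp: coords_def finite_B intro!: sets_PiM_I_finite)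
  also have "\<dots> < \<infinity>"
    using emeasure_cube[of 1] by (simp add: ennreal_power power_less_top_ennreal)
  finally show "emeasure coords solid \<noteq> \<infinity>" by simp
  have "0 < ennreal (2 * (1 / card B)) ^ card B"
    using nonempty finite_B by (simp add: ennreal_power card_gt_0_iff)
  also have "\<dots> = emeasure coords (Pi\<^sub>E B (\<lambda>b. {-1 / card B..1 / card B}))"
    using emeasure_cube[of "1 / card B"] by simp
  also have "\<dots> \<le> emeasure coords solid"
    by (rule emeasure_mono[OF cube_subset_solid]) simp
  finally show "emeasure coords solid \<noteq> 0" by simp
qed

lemma prob_space_ball_measure: "prob_space ball_measure"
  unfolding ball_measure_def using emeasure_solid by (rule prob_space_uniform_measure)

lemma sets_ball_measure [measurable_cong]: "sets ball_measure = sets coords"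
  by (simp add: ball_measure_def)

lemma weight_measurable:
  "S \<in> sets M \<Longrightarrow> (\<lambda>x. indicator S x / emeasure coords solid) \<in> borel_measurable M"
  unfolding divide_ennreal_def by (intro borel_measurable_times_ennreal borel_measurable_indicator) auto

text \<open>Conditioning on the unit ball commutes with taking the image under \<open>point\<close>,
  because \<open>solid\<close> is exactly the preimage of the ball. The two image measures of the
  definition thus collapse into one.\<close>

lemma sphere_measure_eq: "sphere_measure V = distr ball_measure borel direction"
proof -
  have "subspace_lborel V = distr coords borel point"
    by (simp add: subspace_lborel_def chosen[symmetric] Let_def coords_def point_def[abs_def])
  moreover have "uniform_measure (distr coords borel point) (cball 0 1) = distr ball_measure borel point"
  proof -
    have e: "emeasure (distr coords borel point) (cball 0 1) = emeasure coords solid"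
      by (subst emeasure_distr) (auto intro!: arg_cong[of _ _ "emeasure coords"] simp: solid_def)
    have "uniform_measure (distr coords borel point) (cball 0 1) =
        distr (density coords (\<lambda>f. indicator (cball 0 1) (point f) / emeasure coords solid)) borel point"
      unfolding uniform_measure_def e by (rule density_distr[OF weight_measurable[OF borel_closed[OF closed_cball]] point_measurable])
    also have "density coords (\<lambda>f. indicator (cball 0 1) (point f) / emeasure coords solid) = ball_measure"
      unfolding ball_measure_def uniform_measure_def
    proof (rule density_cong)
      show "(\<lambda>f. indicator solid f / emeasure coords solid) \<in> borel_measurable coords"
        by (rule weight_measurable) simp
      show "(\<lambda>f. indicator (cball 0 1) (point f) / emeasure coords solid) \<in> borel_measurable coords"
        by (rule measurable_compose[OF point_measurable weight_measurable]) simp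
    qed (auto simp: solid_def split: split_indicator)
    finally show ?thesis .
  qed
  ultimately show ?thesis
    by (simp add: sphere_measure_def distr_distr o_def direction_def[abs_def])
qed

text \<open>Only the origin is exceptional. In coordinates it is the cube of half side 0, which is
  null since \<open>B\<close> is nonempty.\<close>

lemma AE_direction_norm: "AE f in ball_measure. (\<Sum>b\<in>B. (direction f \<bullet> b)\<^sup>2) = 1"
proof -
  have "AE f in coords. f \<notin> Pi\<^sub>E B (\<lambda>b. {0})"
  proof (rule AE_not_in, rule null_setsI)
    show "Pi\<^sub>E B (\<lambda>b. {0}) \<in> sets coords"
      unfolding coords_def by (rule sets_PiM_I_finite[OF finite_B]) simp
    show "emeasure coords (Pi\<^sub>E B (\<lambda>b. {0})) = 0"
      using emeasure_cube[of 0] nonempty finite_B by (simp add: card_gt_0_iff)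
  qed
  then have "AE f in coords. norm (direction f) = 1"
  proof (rule AE_mp, intro AE_I2 impI)
    fix f assume f: "f \<in> space coords" "f \<notin> Pi\<^sub>E B (\<lambda>b. {0})"
    then obtain b where "b \<in> B" "f b \<noteq> 0"
      unfolding coords_def space_PiM PiE_iff by force
    then have "point f \<noteq> 0" using point_inner[of b f] by auto
    then show "norm (direction f) = 1" by (simp add: direction_def)
  qed
  then have "AE f in ball_measure. norm (direction f) = 1"
    unfolding ball_measure_def by (intro AE_uniform_measureI) auto
  then show ?thesis
  proof (rule AE_mp, intro AE_I2 impI)
    fix f assume "norm (direction f) = 1"
    then show "(\<Sum>b\<in>B. (direction f \<bullet> b)\<^sup>2) = 1"
      using orthonormal_basis_of_norm_sq[OF basis direction_in, of f] by (simp add: norm_eq_1)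
  qed
qed

lemma norm_direction_le: "norm (direction f) \<le> 1"
  by (cases "point f = 0") (simp_all add: direction_def)

lemma norm_point_signed_permute:
  assumes p: "p permutes B" and s: "\<And>b. b \<in> B \<Longrightarrow> s b = 1 \<or> s b = -1"
  shows "norm (point (signed_permute B s p f)) = norm (point f)"
proof -
  have "(s b * f (p b))\<^sup>2 = (f (p b))\<^sup>2" if "b \<in> B" for b
    using s[OF that] by auto
  then have "(\<Sum>b\<in>B. (signed_permute B s p f b)\<^sup>2) = (\<Sum>b\<in>B. (f (p b))\<^sup>2)"
    by (intro sum.cong) (auto simp: signed_permute_def)
  also have "\<dots> = (\<Sum>b\<in>B. (f b)\<^sup>2)"
    using sum.permute[OF p, of "\<lambda>b. (f b)\<^sup>2"] by (simp add: o_def)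
  finally have "(norm (point (signed_permute B s p f)))\<^sup>2 = (norm (point f))\<^sup>2"
    by (simp add: norm_point)
  then show ?thesis by (metis norm_ge_zero power2_eq_imp_eq)
qed

text \<open>A signed permutation preserves the norm, so the weight cutting out the ball agrees with
  its own pullback. \<open>density_distr\<close> then reduces the claim to the invariance of the
  product measure.\<close>

lemma integral_signed_permute:
  fixes h :: "('v \<Rightarrow> real) \<Rightarrow> real"
  assumes p: "p permutes B" and s: "\<And>b. b \<in> B \<Longrightarrow> s b = 1 \<or> s b = -1"
    and h: "h \<in> borel_measurable coords"
  shows "(\<integral>f. h (signed_permute B s p f) \<partial>ball_measure) = (\<integral>f. h f \<partial>ball_measure)"
proof -
  let ?U = "signed_permute B s p"
  have U[measurable]: "?U \<in> coords \<rightarrow>\<^sub>M coords"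
    unfolding coords_def using p by (rule signed_permute_measurable)
  have inv: "distr coords coords ?U = coords"
    unfolding coords_def using finite_B p s by (rule distr_signed_permute)
  have norm: "norm (point (?U f)) = norm (point f)" for f
    using p s by (rule norm_point_signed_permute)
  let ?w = "\<lambda>f. indicator solid f / emeasure coords solid"
  have "distr ball_measure coords ?U = distr (density coords (\<lambda>f. ?w (?U f))) coords ?U"
  proof -
    have "ball_measure = density coords (\<lambda>f. ?w (?U f))"
      unfolding ball_measure_def uniform_measure_def
    proof (rule density_cong)
      have "?U f \<in> space coords" if "f \<in> space coords" for f
        using measurable_space[OF U that] .
      then show "AE f in coords. ?w f = ?w (?U f)"
        by (intro AE_I2) (auto simp: solid_def norm split: split_indicator)
    next
      show "?w \<in> borel_measurable coords" by (rule weight_measurable) simp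
      then show "(\<lambda>f. ?w (?U f)) \<in> borel_measurable coords"
        using U by (rule measurable_compose[rotated])
    qed
    then show ?thesis by simp
  qed
  also have "\<dots> = density (distr coords coords ?U) ?w"
    by (rule density_distr[symmetric, OF weight_measurable[OF solid_measurable] U])
  also have "\<dots> = ball_measure"
    by (simp add: inv ball_measure_def uniform_measure_def)
  finally have "(\<integral>f. h f \<partial>ball_measure) = (\<integral>f. h f \<partial>(distr ball_measure coords ?U))" by simp
  also have "\<dots> = (\<integral>f. h (?U f) \<partial>ball_measure)"
    using h by (intro integral_distr) measurable
  finally show ?thesis ..
qed

lemma direction_signed_permute:
  assumes p: "p permutes B" and s: "\<And>b. b \<in> B \<Longrightarrow> s b = 1 \<or> s b = -1" and b: "b \<in> B"
  shows "direction (signed_permute B s p f) \<bullet> b = s b * (direction f \<bullet> p b)"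
proof -
  let ?U = "signed_permute B s p"
  have norm: "norm (point (?U f)) = norm (point f)"
    using p s by (rule norm_point_signed_permute)
  have "p b \<in> B" using permutes_in_image[OF p] b by simp
  then show ?thesis using b
    by (simp add: direction_def norm point_inner)
      (simp add: signed_permute_def)
qed

lemma integrable_direction:
  assumes "continuous_on UNIV h"
  shows "integrable ball_measure (\<lambda>f. h (direction f) :: real)"
proof -
  interpret prob_space ball_measure by (rule prob_space_ball_measure)
  have "compact (h ` cball 0 1)"
    using assms by (intro compact_continuous_image) (auto intro: continuous_on_subset)
  then obtain K where K: "\<And>x. x \<in> cball 0 1 \<Longrightarrow> norm (h x) \<le> K"
    using compact_imp_bounded[of "h ` cball 0 1"] unfolding bounded_iff by blast
  have "h \<in> borel_measurable borel" using assms by (rule borel_measurable_continuous_onI)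
  then have "(\<lambda>f. h (direction f)) \<in> borel_measurable ball_measure" by measurable
  then show ?thesis
    by (intro integrable_const_bound[of _ K]) (use K norm_direction_le in auto)
qed

text \<open>Flipping all signs is a symmetry that negates the integrand.\<close>

lemma mean_direction:
  assumes b: "b \<in> B"
  shows "(\<integral>f. direction f \<bullet> b \<partial>ball_measure) = 0"
proof -
  have "(\<integral>f. direction (signed_permute B (\<lambda>_. -1) id f) \<bullet> b \<partial>ball_measure)
      = (\<integral>f. direction f \<bullet> b \<partial>ball_measure)"
    by (rule integral_signed_permute) (auto simp: permutes_id[unfolded id_def] id_def)
  moreover have "direction (signed_permute B (\<lambda>_. -1) id f) \<bullet> b = - (direction f \<bullet> b)" for f
    using direction_signed_permute[OF permutes_id _ b, of "\<lambda>_. -1" f] by simp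
  ultimately show ?thesis by simp
qed

text \<open>Flipping the sign of one coordinate negates a mixed product. Transpositions make all the
  second moments equal, and since the squares sum to 1 almost everywhere, each is
  \<open>1 / card B\<close>.\<close>

lemma covariance_direction:
  assumes b: "b \<in> B" and c: "c \<in> B"
  shows "(\<integral>f. (direction f \<bullet> b) * (direction f \<bullet> c) \<partial>ball_measure) = (if b = c then 1 / card B else 0)"
proof (cases "b = c")
  case False
  define s where "s = (\<lambda>x. if x = b then -1 else 1 :: real)"
  have s: "s x = 1 \<or> s x = -1" for x by (simp add: s_def)
  have "(\<integral>f. (direction (signed_permute B s id f) \<bullet> b) * (direction (signed_permute B s id f) \<bullet> c) \<partial>ball_measure)
      = (\<integral>f. (direction f \<bullet> b) * (direction f \<bullet> c) \<partial>ball_measure)"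
    by (rule integral_signed_permute) (auto simp: permutes_id[unfolded id_def] id_def s_def)
  moreover have "direction (signed_permute B s id f) \<bullet> b = - (direction f \<bullet> b)"
      "direction (signed_permute B s id f) \<bullet> c = direction f \<bullet> c" for f
    using direction_signed_permute[OF permutes_id s b, where f=f] direction_signed_permute[OF permutes_id s c, where f=f] False
    by (simp_all add: s_def)
  ultimately show ?thesis using False by simp
next
  case True
  have eq: "(\<integral>f. (direction f \<bullet> d)\<^sup>2 \<partial>ball_measure) = (\<integral>f. (direction f \<bullet> b)\<^sup>2 \<partial>ball_measure)"
    if d: "d \<in> B" for d
  proof -
    define p where "p = Transposition.transpose b d"
    have p: "p permutes B" unfolding p_def using b d by (rule permutes_swap_id)
    have "(\<integral>f. (direction (signed_permute B (\<lambda>_. 1) p f) \<bullet> b)\<^sup>2 \<partial>ball_measure)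
      = (\<integral>f. (direction f \<bullet> b)\<^sup>2 \<partial>ball_measure)"
      by (rule integral_signed_permute) (auto simp: p)
    moreover have "direction (signed_permute B (\<lambda>_. 1) p f) \<bullet> b = direction f \<bullet> d" for f
      using direction_signed_permute[OF p _ b, of "\<lambda>_. 1" f] by (simp add: p_def)
    ultimately show ?thesis by simp
  qed
  have int: "integrable ball_measure (\<lambda>f. (direction f \<bullet> d)\<^sup>2)" for d
    by (rule integrable_direction) (intro continuous_intros)
  interpret prob_space ball_measure by (rule prob_space_ball_measure)
  have "real (card B) * (\<integral>f. (direction f \<bullet> b)\<^sup>2 \<partial>ball_measure)
      = (\<Sum>d\<in>B. \<integral>f. (direction f \<bullet> d)\<^sup>2 \<partial>ball_measure)"
    by (simp add: eq)
  also have "\<dots> = (\<integral>f. (\<Sum>d\<in>B. (direction f \<bullet> d)\<^sup>2) \<partial>ball_measure)"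
    by (rule Bochner_Integration.integral_sum[symmetric]) (rule int)
  also have "\<dots> = (\<integral>f. 1 \<partial>ball_measure)"
    using AE_direction_norm by (intro integral_cong_AE) measurable
  also have "\<dots> = 1" by (simp add: prob_space)
  finally show ?thesis
    using True nonempty finite_B by (simp add: power2_eq_square field_simps card_gt_0_iff)
qed

text \<open>After expansion in the basis, the vanishing mean removes the linear term, and the
  covariance leaves only the diagonal entries of \<open>A\<close>, that is, its trace on
  \<open>V\<close> divided by the dimension.\<close>

lemma integral_sphere_measure_quadratic:
  assumes A: "linear A"
  shows "(\<integral>x. c + a \<bullet> x + x \<bullet> A x \<partial>sphere_measure V) = c + (\<Sum>b\<in>B. b \<bullet> A b) / card B"
proof -
  interpret prob_space ball_measure by (rule prob_space_ball_measure)
  have contA: "continuous_on UNIV A" using A linear_continuous_on linear_conv_bounded_linear by blast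
  have meas: "(\<lambda>x. c + a \<bullet> x + x \<bullet> A x) \<in> borel_measurable borel"
    using contA by (intro borel_measurable_continuous_onI continuous_intros) auto
  have expand: "a \<bullet> direction f = (\<Sum>b\<in>B. (a \<bullet> b) * (direction f \<bullet> b))"
      "direction f \<bullet> A (direction f)
        = (\<Sum>b\<in>B. \<Sum>d\<in>B. (b \<bullet> A d) * ((direction f \<bullet> b) * (direction f \<bullet> d)))" for f
  proof -
    let ?x = "direction f"
    have x: "?x = (\<Sum>b\<in>B. (?x \<bullet> b) *\<^sub>R b)"
      by (rule orthonormal_basis_of_expansion[OF basis direction_in])
    have "a \<bullet> ?x = a \<bullet> (\<Sum>b\<in>B. (?x \<bullet> b) *\<^sub>R b)" using x by simp
    then show "a \<bullet> ?x = (\<Sum>b\<in>B. (a \<bullet> b) * (?x \<bullet> b))"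
      by (simp add: inner_sum_right mult.commute)
    show "?x \<bullet> A ?x = (\<Sum>b\<in>B. \<Sum>d\<in>B. (b \<bullet> A d) * ((?x \<bullet> b) * (?x \<bullet> d)))"
      by (rule orthonormal_basis_of_quadratic_form[OF basis direction_in A])
  qed
  have int1: "integrable ball_measure (\<lambda>f. direction f \<bullet> b)" for b
    by (rule integrable_direction) (intro continuous_intros)
  have int2: "integrable ball_measure (\<lambda>f. (direction f \<bullet> b) * (direction f \<bullet> d))" for b d
    by (rule integrable_direction) (intro continuous_intros)
  have i1: "integrable ball_measure (\<lambda>f. a \<bullet> direction f)"
    by (rule integrable_direction) (intro continuous_intros)
  have i2: "integrable ball_measure (\<lambda>f. direction f \<bullet> A (direction f))"
    using contA by (intro integrable_direction continuous_intros) auto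
  have e1: "(\<integral>f. a \<bullet> direction f \<partial>ball_measure) = 0"
    unfolding expand by (subst Bochner_Integration.integral_sum) (auto simp: int1 mean_direction)
  have "(\<integral>f. direction f \<bullet> A (direction f) \<partial>ball_measure)
      = (\<Sum>b\<in>B. \<Sum>d\<in>B. (b \<bullet> A d) * (\<integral>f. (direction f \<bullet> b) * (direction f \<bullet> d) \<partial>ball_measure))"
    unfolding expand by (subst Bochner_Integration.integral_sum, force simp: int2)+ (simp add: int2)
  also have "\<dots> = (\<Sum>b\<in>B. \<Sum>d\<in>B. if b = d then (b \<bullet> A b) / card B else 0)"
    by (intro sum.cong refl) (auto simp: covariance_direction)
  also have "\<dots> = (\<Sum>b\<in>B. b \<bullet> A b) / card B"
    using finite_B by (simp add: sum_divide_distrib)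
  finally have e2: "(\<integral>f. direction f \<bullet> A (direction f) \<partial>ball_measure) = (\<Sum>b\<in>B. b \<bullet> A b) / card B" .
  have "(\<integral>x. c + a \<bullet> x + x \<bullet> A x \<partial>sphere_measure V)
      = (\<integral>f. c + a \<bullet> direction f + direction f \<bullet> A (direction f) \<partial>ball_measure)"
    unfolding sphere_measure_eq using meas by (subst integral_distr) auto
  also have "\<dots> = c + (\<Sum>b\<in>B. b \<bullet> A b) / card B"
    using i1 i2 by (simp add: e1 e2 prob_space)
  finally show ?thesis .
qed

end

text \<open>The locale is instantiated with the basis selected in \<open>subspace_lborel\<close>,
  which is why \<open>B\<close> is obtained rather than arbitrary. A space other than
  \<open>{0}\<close> has a nonempty basis.\<close>

lemma sphere_measure_quadratic:
  fixes V :: "'v::euclidean_space set"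
  assumes "subspace V" "V \<noteq> {0}"
  obtains B where "orthonormal_basis_of B V" "B \<noteq> {}"
    "\<And>c a A. linear A \<Longrightarrow>
       (\<integral>x. c + a \<bullet> x + x \<bullet> A x \<partial>sphere_measure V) = c + (\<Sum>b\<in>B. b \<bullet> A b) / card B"
proof -
  define B where "B = (SOME B. orthonormal_basis_of B V)"
  obtain B' where "orthonormal_basis_of B' V" using assms(1) by (rule orthonormal_basis_of_exists)
  then have B: "orthonormal_basis_of B V" unfolding B_def by (rule someI)
  with assms(2) have "B \<noteq> {}" by (auto simp: orthonormal_basis_of_def)
  then interpret sphere_coordinates V B
    using assms(1) B B_def by unfold_locales
  show ?thesis
    using that B \<open>B \<noteq> {}\<close> integral_sphere_measure_quadratic by blast
qed

section \<open>Second-moment criterion for antipodal 2-designs\<close>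

text \<open>
  The constant \<open>c\<close> need not be specified: taking traces in the identity forces
  \<open>c * dim V = card Y\<close>.
\<close>

lemma spherical_design_2_iff:
  fixes V :: "'v::euclidean_space set"
  assumes V: "subspace V" and Y: "finite Y" "Y \<noteq> {}" "Y \<subseteq> V \<inter> sphere 0 1"
    and sym: "uminus ` Y = Y"
  shows "spherical_design 2 V Y \<longleftrightarrow> (\<exists>c. \<forall>z\<in>V. (\<Sum>y\<in>Y. (y \<bullet> z)\<^sup>2) = c * (z \<bullet> z))"
proof -
  obtain y0 where "y0 \<in> Y" using Y by blast
  then have "V \<noteq> {0}" using Y(3) by auto
  with V obtain B where B: "orthonormal_basis_of B V" "B \<noteq> {}"
    and int: "\<And>c a A. linear A \<Longrightarrow>
       (\<integral>x. c + a \<bullet> x + x \<bullet> A x \<partial>sphere_measure V) = c + (\<Sum>b\<in>B. b \<bullet> A b) / card B"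
    by (rule sphere_measure_quadratic) blast
  have fB: "finite B" using B(1) by (rule orthonormal_basis_of_finite)
  have BV: "B \<subseteq> V" using B(1) by (auto simp: orthonormal_basis_of_def intro: span_base)
  have nB: "real (card B) > 0" and nY: "real (card Y) > 0"
    using B(2) fB Y by (auto simp: card_gt_0_iff)
  show ?thesis
  proof
    assume des: "spherical_design 2 V Y"
    have "(\<Sum>y\<in>Y. (y \<bullet> z)\<^sup>2) = (card Y / card B) * (z \<bullet> z)" if z: "z \<in> V" for z
    proof -
      \<comment> \<open>This rank-one operator represents the square as a quadratic form; its trace
        over \<open>B\<close> is \<open>z \<bullet> z\<close>.\<close>
      have lin: "linear (\<lambda>x. (x \<bullet> z) *\<^sub>R z)"
        by (simp add: linear_iff inner_add_left scaleR_add_left)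
      have sq: "(x \<bullet> z)\<^sup>2 = 0 + 0 \<bullet> x + x \<bullet> ((x \<bullet> z) *\<^sub>R z)" for x
        by (simp add: power2_eq_square)
      have "(\<integral>x. (x \<bullet> z)\<^sup>2 \<partial>sphere_measure V) = 0 + (\<Sum>b\<in>B. b \<bullet> ((b \<bullet> z) *\<^sub>R z)) / card B"
        unfolding sq by (rule int[OF lin])
      also have "\<dots> = (z \<bullet> z) / card B"
        using orthonormal_basis_of_norm_sq[OF B(1) z] by (simp add: power2_eq_square inner_commute)
      finally have "(\<integral>x. (x \<bullet> z)\<^sup>2 \<partial>sphere_measure V) = (z \<bullet> z) / card B" .
      moreover have "(\<integral>x. (x \<bullet> z)\<^sup>2 \<partial>sphere_measure V) = (1 / real (card Y)) * (\<Sum>y\<in>Y. (y \<bullet> z)\<^sup>2)"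
        using des real_polynomial_deg_le_inner_square[of z] unfolding spherical_design_def by blast
      ultimately show ?thesis using nY nB by (simp add: field_simps)
    qed
    then show "\<exists>c. \<forall>z\<in>V. (\<Sum>y\<in>Y. (y \<bullet> z)\<^sup>2) = c * (z \<bullet> z)" by blast
  next
    assume "\<exists>c. \<forall>z\<in>V. (\<Sum>y\<in>Y. (y \<bullet> z)\<^sup>2) = c * (z \<bullet> z)"
    then obtain k where k: "\<And>z. z \<in> V \<Longrightarrow> (\<Sum>y\<in>Y. (y \<bullet> z)\<^sup>2) = k * (z \<bullet> z)" by blast
    \<comment> \<open>Polarisation passes from squares to products, which supplies the off-diagonal
      terms met by a general operator \<open>A\<close>.\<close>
    have polar: "(\<Sum>y\<in>Y. (y \<bullet> b) * (y \<bullet> d)) = k * (b \<bullet> d)" if "b \<in> V" "d \<in> V" for b d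
    proof -
      have "(y \<bullet> b) * (y \<bullet> d) = ((y \<bullet> (b + d))\<^sup>2 - (y \<bullet> b)\<^sup>2 - (y \<bullet> d)\<^sup>2) / 2" for y
        by (simp add: inner_add_right power2_eq_square algebra_simps)
      then have "(\<Sum>y\<in>Y. (y \<bullet> b) * (y \<bullet> d)) = (\<Sum>y\<in>Y. ((y \<bullet> (b + d))\<^sup>2 - (y \<bullet> b)\<^sup>2 - (y \<bullet> d)\<^sup>2) / 2)"
        by (intro sum.cong) auto
      also have "\<dots> = ((\<Sum>y\<in>Y. (y \<bullet> (b + d))\<^sup>2) - (\<Sum>y\<in>Y. (y \<bullet> b)\<^sup>2) - (\<Sum>y\<in>Y. (y \<bullet> d)\<^sup>2)) / 2"
        by (simp add: sum_subtractf flip: sum_divide_distrib)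
      also have "\<dots> = k * (b \<bullet> d)"
        by (simp only: k[OF that(1)] k[OF that(2)] k[OF subspace_add[OF V that]])
           (simp add: inner_add_left inner_add_right inner_commute[of d b] algebra_simps)
      finally show ?thesis .
    qed
    have "real (card Y) = (\<Sum>y\<in>Y. y \<bullet> y)"
      using Y(3) by (subst sum.cong[of Y Y _ "\<lambda>_. 1"]) (auto simp: norm_eq_1)
    also have "\<dots> = (\<Sum>y\<in>Y. \<Sum>b\<in>B. (y \<bullet> b)\<^sup>2)"
      using Y(3) by (intro sum.cong refl orthonormal_basis_of_norm_sq[OF B(1)]) auto
    also have "\<dots> = (\<Sum>b\<in>B. \<Sum>y\<in>Y. (y \<bullet> b)\<^sup>2)" by (rule sum.swap)
    also have "\<dots> = (\<Sum>b\<in>B. k)"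
      using k BV orthonormal_basis_of_inner[OF B(1)] by (intro sum.cong) auto
    finally have kB: "k * card B = card Y" by simp
    \<comment> \<open>Antipodality of \<open>Y\<close> disposes of the linear terms, just as the
      antipodal symmetry does for the sphere.\<close>
    have mean: "(\<Sum>y\<in>Y. a \<bullet> y) = 0" for a
    proof -
      have "(\<Sum>y\<in>Y. a \<bullet> y) = (\<Sum>y\<in>uminus ` Y. a \<bullet> y)" by (simp only: sym)
      also have "\<dots> = - (\<Sum>y\<in>Y. a \<bullet> y)"
        by (subst sum.reindex) (auto simp: sum_negf)
      finally show ?thesis by simp
    qed
    have quad: "(\<Sum>y\<in>Y. y \<bullet> A y) = k * (\<Sum>b\<in>B. b \<bullet> A b)" if A: "linear A" for A
    proof -
      have "(\<Sum>y\<in>Y. y \<bullet> A y) = (\<Sum>y\<in>Y. \<Sum>b\<in>B. \<Sum>d\<in>B. (b \<bullet> A d) * ((y \<bullet> b) * (y \<bullet> d)))"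
        using Y(3) by (intro sum.cong refl orthonormal_basis_of_quadratic_form[OF B(1) _ A]) auto
      also have "\<dots> = (\<Sum>b\<in>B. \<Sum>d\<in>B. (b \<bullet> A d) * (\<Sum>y\<in>Y. (y \<bullet> b) * (y \<bullet> d)))"
        by (subst sum.swap, rule sum.cong[OF refl], subst sum.swap) (simp add: sum_distrib_left)
      also have "\<dots> = (\<Sum>b\<in>B. \<Sum>d\<in>B. if b = d then k * (b \<bullet> A b) else 0)"
        using BV by (intro sum.cong refl)
          (auto simp: polar subsetD orthonormal_basis_of_inner[OF B(1)])
      also have "\<dots> = k * (\<Sum>b\<in>B. b \<bullet> A b)" using fB by (simp add: sum_distrib_left)
      finally show ?thesis .
    qed
    show "spherical_design 2 V Y"
      unfolding spherical_design_def
    proof (intro conjI allI impI)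
      fix f :: "'v \<Rightarrow> real" assume "real_polynomial_deg_le 2 f"
      then obtain c a A where A: "linear A" and f: "f = (\<lambda>x. c + a \<bullet> x + x \<bullet> A x)"
        using real_polynomial_deg_le_2_quadratic[of 2 f] by auto
      have sum: "(\<Sum>y\<in>Y. f y) = card Y * c + k * (\<Sum>b\<in>B. b \<bullet> A b)"
        by (simp add: f sum.distrib mean quad[OF A])
      have int_f: "(\<integral>x. f x \<partial>sphere_measure V) = c + (\<Sum>b\<in>B. b \<bullet> A b) / card B"
        unfolding f by (rule int[OF A])
      \<comment> \<open>Multiplying by \<open>card Y = k * card B\<close> turns the averaged trace
        into \<open>k\<close> times the trace, which is what the finite sum produces.\<close>
      have "card Y * (\<integral>x. f x \<partial>sphere_measure V) = card Y * c + k * (card B * ((\<Sum>b\<in>B. b \<bullet> A b) / card B))"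
        unfolding int_f kB[symmetric] by (simp only: distrib_left mult.assoc)
      also have "\<dots> = (\<Sum>y\<in>Y. f y)" unfolding sum using nB by simp
      finally show "(\<integral>x. f x \<partial>sphere_measure V) = (1 / real (card Y)) * (\<Sum>y\<in>Y. f y)"
        using nY by (simp add: eq_divide_eq mult.commute)
    qed (use Y in auto)
  qed
qed

section \<open>Elementary abelian 2-groups\<close>

lemma (in comm_group) finprod_generate:
  assumes "finite I" "\<And>i. i \<in> I \<Longrightarrow> f i \<in> generate G S" "S \<subseteq> carrier G"
  shows "(\<Otimes>i\<in>I. f i) \<in> generate G S"
  using assms(1,2)
proof (induction I)
  case empty
  then show ?case by (simp add: generate.one)
next
  case (insert i I)
  then show ?case
    using generate_incl[OF assms(3)] by (auto intro!: generate.eng simp: subset_iff Pi_iff)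
qed

text \<open>A generating set of least size serves as a basis over the field with two elements. The
  product map \<open>\<theta>\<close> is a homomorphism by exponent two, surjective by generation,
  and injective by minimality, since a nontrivial relation would express one generator through the
  others.\<close>

lemma (in comm_group) elementary_two_group_basis:
  assumes fin: "finite (carrier G)" and exp: "\<And>x. x \<in> carrier G \<Longrightarrow> x \<otimes> x = \<one>"
  shows "\<exists>\<nu>. G \<cong> product_group {..<\<nu>::nat} (\<lambda>_. integer_mod_group 2)"
proof -
  define gens where "gens = (\<lambda>B. B \<subseteq> carrier G \<and> generate G B = carrier G)"
  have "gens (carrier G)"
    unfolding gens_def using generate_incl[of "carrier G"] by (auto intro: generate.incl)
  then obtain B where B: "gens B" and min: "\<And>C. gens C \<Longrightarrow> card B \<le> card C"
    using ex_has_least_nat[of gens "carrier G" card] by blast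
  have BG: "B \<subseteq> carrier G" and genB: "generate G B = carrier G" using B by (auto simp: gens_def)
  have fB: "finite B" using BG fin by (rule finite_subset)
  define \<nu> where "\<nu> = card B"
  obtain e where e: "bij_betw e {..<\<nu>} B"
    unfolding \<nu>_def using ex_bij_betw_nat_finite[OF fB] atLeast0LessThan by auto
  have eG: "e i \<in> carrier G" if "i < \<nu>" for i
    using bij_betwE[OF e] BG that by blast
  let ?P = "product_group {..<\<nu>} (\<lambda>_. integer_mod_group 2)"
  have P: "group ?P" by (rule product_group) simp
  have PD: "f i \<in> {0, 1}" if "f \<in> carrier ?P" "i < \<nu>" for f i
  proof -
    have "f \<in> (\<Pi>\<^sub>E i\<in>{..<\<nu>}. carrier (integer_mod_group 2))"
      using that(1) by (simp only: carrier_product_group)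
    then have "f i \<in> carrier (integer_mod_group 2)"
      by (rule PiE_mem) (simp add: that(2))
    then have "0 \<le> f i \<and> f i < 2"
      by (simp add: carrier_integer_mod_group)
    then show ?thesis by auto
  qed
  define \<theta> where "\<theta> = (\<lambda>f. \<Otimes>i\<in>{..<\<nu>}. e i [^] (f i :: int))"
  \<comment> \<open>Multiplication in the product group reduces exponents modulo 2; exponent two
    makes this reduction invisible in \<open>G\<close>.\<close>
  have mod2: "e i [^] (k mod 2) = e i [^] k" if "i < \<nu>" for i and k :: int
  proof -
    have "e i [^] k = e i [^] (2 * (k div 2) + k mod 2)" by simp
    also have "\<dots> = (e i [^] (2 :: int)) [^] (k div 2) \<otimes> e i [^] (k mod 2)"
      using eG[OF that] by (simp only: int_pow_mult int_pow_pow)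
    also have "e i [^] (2 :: int) = \<one>"
      using exp[OF eG[OF that]] eG[OF that] int_pow_mult[of "e i" 1 1] by (simp add: int_pow_1)
    finally show ?thesis using eG[OF that] by simp
  qed
  have hom: "\<theta> \<in> hom ?P G"
  proof (rule homI)
    fix f h assume f: "f \<in> carrier ?P" and h: "h \<in> carrier ?P"
    have "\<theta> (f \<otimes>\<^bsub>?P\<^esub> h) = (\<Otimes>i\<in>{..<\<nu>}. e i [^] f i \<otimes> e i [^] h i)"
      unfolding \<theta>_def using eG by (intro finprod_cong') (auto simp: mod2 int_pow_mult)
    also have "\<dots> = \<theta> f \<otimes> \<theta> h"
      unfolding \<theta>_def using eG by (intro finprod_multf) auto
    finally show "\<theta> (f \<otimes>\<^bsub>?P\<^esub> h) = \<theta> f \<otimes> \<theta> h" .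
  qed (auto simp: \<theta>_def eG)
  then interpret \<theta>: group_hom ?P G \<theta>
    using P by (simp add: group_hom_def group_hom_axioms_def is_group)
  have inj: "inj_on \<theta> (carrier ?P)"
    unfolding \<theta>.inj_on_one_iff
  proof (intro allI impI)
    fix f assume f: "f \<in> carrier ?P" and one: "\<theta> f = \<one>"
    have "f k = 0" if k: "k < \<nu>" for k
    proof (rule ccontr)
      assume "f k \<noteq> 0"
      with PD[OF f k] have fk: "f k = 1" by auto
      let ?r = "\<Otimes>i\<in>{..<\<nu>} - {k}. e i [^] f i"
      have rG: "?r \<in> carrier G" using eG by (intro finprod_closed) auto
      have "\<theta> f = (\<Otimes>i\<in>insert k ({..<\<nu>} - {k}). e i [^] f i)"
        unfolding \<theta>_def using k by (simp add: insert_absorb)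
      also have "\<dots> = e k [^] f k \<otimes> ?r"
        using eG k by (subst finprod_insert) auto
      finally have "e k \<otimes> ?r = \<one>" using one fk eG[OF k] by (simp add: int_pow_1)
      \<comment> \<open>As \<open>?r\<close> is its own inverse, the relation says that
        \<open>e k\<close> is a product of other generators. Dropping \<open>e k\<close> then leaves
        a smaller generating set.\<close>
      then have "e k \<otimes> ?r = ?r \<otimes> ?r" using exp[OF rG] by simp
      then have ek: "e k = ?r" using right_cancel[OF rG eG[OF k] rG] by simp
      have memB: "e i \<in> B - {e k}" if "i < \<nu>" "i \<noteq> k" for i
        using e that k by (auto simp: bij_betw_def inj_on_def)
      have sub: "B - {e k} \<subseteq> carrier G" using BG by auto
      have "e i [^] f i \<in> generate G (B - {e k})" if "i \<in> {..<\<nu>} - {k}" for i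
      proof -
        have "e i \<in> generate G (B - {e k})" using memB that by (auto intro: generate.incl)
        then show ?thesis
          using PD[OF f, of i] that eG[of i] by (auto simp: generate.one int_pow_1)
      qed
      then have "e k \<in> generate G (B - {e k})"
        by (subst ek) (intro finprod_generate sub, auto)
      then have "B \<subseteq> generate G (B - {e k})" by (auto intro: generate.incl)
      then have "carrier G \<subseteq> generate G (B - {e k})"
        using generate_subgroup_incl[OF _ generate_is_subgroup[OF sub], of B] genB by simp
      then have "gens (B - {e k})"
        using sub generate_incl[OF sub] by (auto simp: gens_def)
      from min[OF this] have "card B \<le> card (B - {e k})" .
      moreover have "e k \<in> B" using e k by (auto simp: bij_betw_def)
      ultimately show False using fB card_Diff1_less[of B "e k"] by simp
    qed
    then show "f = \<one>\<^bsub>?P\<^esub>"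
      using f by (auto simp: fun_eq_iff PiE_iff extensional_def)
  qed
  have "e k \<in> \<theta> ` carrier ?P" if k: "k < \<nu>" for k
  proof -
    define f where "f = (\<lambda>i\<in>{..<\<nu>}. if i = k then 1 else 0 :: int)"
    have "f \<in> carrier ?P" by (auto simp: f_def carrier_integer_mod_group)
    moreover have "\<theta> f = (\<Otimes>i\<in>{..<\<nu>}. if k = i then e i else \<one>)"
      unfolding \<theta>_def using eG by (intro finprod_cong') (auto simp: f_def int_pow_1)
    then have "\<theta> f = e k"
      using finprod_singleton[of k "{..<\<nu>}" e] k eG by auto
    ultimately show ?thesis by force
  qed
  then have "B \<subseteq> \<theta> ` carrier ?P" using e by (auto simp: bij_betw_def)
  then have "carrier G \<subseteq> \<theta> ` carrier ?P"
    using generate_subgroup_incl[OF _ \<theta>.img_is_subgroup, of B] genB by simp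
  then have "bij_betw \<theta> (carrier ?P) (carrier G)"
    using inj \<theta>.hom_closed by (auto simp: bij_betw_def)
  then have "\<theta> \<in> iso ?P G" using hom by (simp add: iso_def)
  then have "?P \<cong> G" by (rule is_isoI)
  then have "G \<cong> ?P" using P group.iso_sym by blast
  then show ?thesis by blast
qed

text \<open>Exponent two is pulled back along the injective homomorphism. The bound on the order
  excludes \<open>\<nu> = 0\<close>, whose product group is trivial.\<close>

lemma (in comm_group) elementary_two_group_iff:
  assumes "finite (carrier G)" "order G \<ge> 2"
  shows "(\<exists>\<nu>\<ge>1. G \<cong> product_group {..<\<nu>::nat} (\<lambda>_. integer_mod_group 2)) \<longleftrightarrow>
           (\<forall>x\<in>carrier G. x \<otimes> x = \<one>)"
proof
  assume "\<exists>\<nu>\<ge>1. G \<cong> product_group {..<\<nu>::nat} (\<lambda>_. integer_mod_group 2)"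
  then obtain \<nu> \<phi> where \<phi>: "\<phi> \<in> iso G (product_group {..<\<nu>::nat} (\<lambda>_. integer_mod_group 2))"
    (is "_ \<in> iso G ?P") by (auto simp: is_iso_def)
  have hom: "\<phi> \<in> hom G ?P" and inj: "inj_on \<phi> (carrier G)" using \<phi> by (auto simp: iso_def bij_betw_def)
  interpret \<phi>: group_hom G ?P \<phi>
    using hom by (auto simp: group_hom_def group_hom_axioms_def is_group intro!: product_group)
  show "\<forall>x\<in>carrier G. x \<otimes> x = \<one>"
  proof
    fix x assume x: "x \<in> carrier G"
    have "\<phi> (x \<otimes> x) = \<phi> \<one>"
      using hom_mult[OF hom x x] \<phi>.hom_one by (auto simp: fun_eq_iff)
    then show "x \<otimes> x = \<one>" using inj x inj_onD[OF inj, of "x \<otimes> x" \<one>] by auto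
  qed
next
  assume exp: "\<forall>x\<in>carrier G. x \<otimes> x = \<one>"
  obtain \<nu> :: nat where iso: "G \<cong> product_group {..<\<nu>} (\<lambda>_. integer_mod_group 2)"
    using elementary_two_group_basis[OF assms(1)] exp by blast
  have "\<nu> \<noteq> 0"
  proof
    assume "\<nu> = 0"
    then have "order G = 1" using iso_same_card[OF iso] by (simp add: order_def)
    with assms(2) show False by simp
  qed
  with iso show "\<exists>\<nu>\<ge>1. G \<cong> product_group {..<\<nu>::nat} (\<lambda>_. integer_mod_group 2)"
    by (intro exI[of _ \<nu>]) auto
qed

section \<open>Elements of order two\<close>

text \<open>\<open>sylow_thm\<close> provides a subgroup for any prime power dividing the order;
  with exponent 1 it acts as Cauchy's theorem for the prime 2.\<close>

lemma (in group) exists_involution: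
  assumes "finite (carrier G)" "even (order G)"
  shows "\<exists>x\<in>carrier G. x \<noteq> \<one> \<and> x \<otimes> x = \<one>"
proof -
  obtain m where "order G = 2 ^ 1 * m" using assms(2) by auto
  then obtain H where H: "subgroup H G" "card H = 2"
    using sylow_thm[of 2 G 1 m] assms(1) is_group by auto
  then obtain x where x: "x \<in> H" "x \<noteq> \<one>"
    by (metis card_2_iff' subgroup.one_closed)
  interpret H: group "G\<lparr>carrier := H\<rparr>" using H(1) by (rule subgroup_imp_group)
  have "x \<otimes> x = \<one>"
    using H.pow_order_eq_1[of x] x H(2) subgroup.mem_carrier[OF H(1)]
    by (simp add: order_def numeral_2_eq_2)
  then show ?thesis using x subgroup.mem_carrier[OF H(1)] by blast
qed

text \<open>If the order is \<open>2 * k + 1\<close>, the power of \<open>x\<close> to the order is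
  both \<open>x\<close> and the neutral element.\<close>

lemma (in group) odd_order_involution:
  assumes "odd (order G)" "x \<in> carrier G" "x \<otimes> x = \<one>"
  shows "x = \<one>"
proof -
  obtain k where k: "order G = 2 * k + 1" using assms(1) by (elim oddE)
  have "x [^] order G = (x [^] (2::nat)) [^] k \<otimes> x"
    using assms(2) by (simp add: k nat_pow_pow)
  also have "x [^] (2::nat) = \<one>" using assms(2,3) by (simp add: numeral_2_eq_2)
  finally show ?thesis using assms(2) pow_order_eq_1[of x] by simp
qed

section \<open>The lattice of a finite abelian group\<close>

lemma card_2_other_element:
  assumes "card A = 2" "a \<in> A"
  shows "\<exists>b. A = {a, b} \<and> a \<noteq> b"
  using assms unfolding card_2_iff by (metis doubleton_eq_iff insertE singletonD)

lemma real_card_Compl: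
  "real (card (UNIV - X)) = real CARD('n) - real (card X)" for X :: "'n::finite set"
  by (subst card_Diff_subset) (auto simp: card_mono)

section \<open>Coordinates indexed by group elements\<close>

locale indexed_group = comm_group G for G (structure) +
  fixes g :: "'n::finite \<Rightarrow> 'a" and o1 :: 'n
  assumes bij: "bij_betw g UNIV (carrier G)" and g_o1: "g o1 = \<one>"
begin

definition "idx = inv_into UNIV g"

text \<open>Transporting the group law to the index type lets translations act on coordinate
  positions. The interpretation \<open>ix\<close> makes the indices an additive abelian group with
  zero \<open>o1\<close>, so that its simplification rules apply.\<close>

definition add (infixl "\<boxplus>" 65) where "i \<boxplus> j = idx (g i \<otimes> g j)"

definition neg where "neg i = idx (inv (g i))"

definition sub (infixl "\<boxminus>" 65) where "i \<boxminus> j = i \<boxplus> neg j"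

lemma g_closed [simp]: "g i \<in> carrier G"
  using bij by (auto simp: bij_betw_def)

lemma g_eq_iff: "g i = g j \<longleftrightarrow> i = j"
  using bij by (auto simp: bij_betw_def inj_on_def)

lemma g_idx: "x \<in> carrier G \<Longrightarrow> g (idx x) = x"
  using bij by (simp add: idx_def bij_betw_def f_inv_into_f)

lemma g_add: "g (i \<boxplus> j) = g i \<otimes> g j"
  by (simp add: add_def g_idx)

lemma g_neg: "g (neg i) = inv (g i)"
  by (simp add: neg_def g_idx)

sublocale ix: ab_group_add "(\<boxplus>)" o1 "(\<boxminus>)" neg
  by unfold_locales
    (simp_all add: g_add g_neg g_o1 m_ac sub_def l_inv flip: g_eq_iff)

lemma order_eq: "order G = CARD('n)"
  using bij_betw_same_card[OF bij] by (simp add: order_def)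

section \<open>Evaluation of integer vectors in the group\<close>

text \<open>The product runs over all indices, including \<open>o1\<close>, so that it can be
  reindexed by translations; the additional factor is a power of the neutral element.\<close>

definition \<phi> :: "('n \<Rightarrow> int) \<Rightarrow> 'a" where "\<phi> x = (\<Otimes>j\<in>UNIV. g j [^] x j)"

lemma \<phi>_closed [simp]: "\<phi> x \<in> carrier G"
  unfolding \<phi>_def by (rule finprod_closed) auto

lemma \<phi>_add: "\<phi> (\<lambda>i. x i + y i) = \<phi> x \<otimes> \<phi> y"
  unfolding \<phi>_def by (subst finprod_multf[symmetric]) (auto simp: int_pow_mult)

lemma \<phi>_single: "\<phi> (\<lambda>i. if a = i then k else 0) = g a [^] k"
proof -
  have "\<phi> (\<lambda>i. if a = i then k else 0) = (\<Otimes>i\<in>UNIV. if a = i then g i [^] k else \<one>)"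
    unfolding \<phi>_def by (rule finprod_cong') auto
  then show ?thesis using finprod_singleton[of a UNIV "\<lambda>i. g i [^] k"] by simp
qed

lemma \<phi>_zero: "\<phi> (\<lambda>i. 0) = \<one>"
  unfolding \<phi>_def by simp

lemma \<phi>_uminus: "\<phi> (\<lambda>i. - x i) = inv \<phi> x"
  using \<phi>_add[of "\<lambda>i. - x i" x] by (simp add: \<phi>_zero inv_equality)

lemma finprod_int_pow:
  assumes "finite I" "c \<in> carrier G"
  shows "(\<Otimes>i\<in>I. c [^] (x i :: int)) = c [^] (\<Sum>i\<in>I. x i)"
  using assms(1) by induction (auto simp: assms(2) int_pow_mult)

text \<open>Reindexing by a translation multiplies the value by a power of \<open>g h\<close> whose
  exponent is the coordinate sum, hence by the neutral element.\<close>

lemma \<phi>_shift: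
  assumes "(\<Sum>i\<in>UNIV. x i) = 0"
  shows "\<phi> (\<lambda>i. x (i \<boxplus> h)) = \<phi> x"
proof -
  have inj: "inj (\<lambda>i. i \<boxplus> h)" by (rule injI) simp
  then have range: "range (\<lambda>i. i \<boxplus> h) = UNIV" by (rule finite_UNIV_inj_surj[OF finite])
  have "\<phi> x = (\<Otimes>i\<in>UNIV. g (i \<boxplus> h) [^] x (i \<boxplus> h))"
    unfolding \<phi>_def using finprod_reindex[of "\<lambda>j. g j [^] x j" "\<lambda>i. i \<boxplus> h" UNIV] inj
    by (simp add: range)
  also have "\<dots> = (\<Otimes>i\<in>UNIV. g i [^] x (i \<boxplus> h) \<otimes> g h [^] x (i \<boxplus> h))"
    by (rule finprod_cong') (auto simp: g_add int_pow_distrib)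
  also have "\<dots> = \<phi> (\<lambda>i. x (i \<boxplus> h)) \<otimes> (\<Otimes>i\<in>UNIV. g h [^] x (i \<boxplus> h))"
    unfolding \<phi>_def by (rule finprod_multf) auto
  also have "(\<Otimes>i\<in>UNIV. g h [^] x (i \<boxplus> h)) = g h [^] (\<Sum>i\<in>UNIV. x (i \<boxplus> h))"
    by (rule finprod_int_pow) auto
  also have "(\<Sum>i\<in>UNIV. x (i \<boxplus> h)) = (\<Sum>i\<in>UNIV. x i)"
    using sum.reindex[OF inj, of x] by (simp add: range)
  finally show ?thesis using assms by simp
qed

section \<open>The lattice as integer relations, and its span\<close>

abbreviation "L \<equiv> group_lattice G g o1"

definition emb :: "('n \<Rightarrow> int) \<Rightarrow> real ^ 'n" where "emb x = (\<chi> i. real_of_int (x i))"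

lemma emb_nth [simp]: "emb x $ i = real_of_int (x i)"
  by (simp add: emb_def)

lemma emb_eq_iff [simp]: "emb x = emb y \<longleftrightarrow> x = y"
  by (auto simp: vec_eq_iff)

definition relations :: "('n \<Rightarrow> int) set" where
  "relations = {x. (\<Sum>i\<in>UNIV. x i) = 0 \<and> \<phi> x = \<one>}"

lemma lattice_eq: "L = emb ` relations"
proof -
  have "\<phi> x = (\<Otimes>j\<in>UNIV - {o1}. g j [^] x j)" for x
  proof -
    have "\<phi> x = (\<Otimes>j\<in>insert o1 (UNIV - {o1}). g j [^] x j)"
      by (simp add: \<phi>_def insert_absorb)
    also have "\<dots> = (\<Otimes>j\<in>UNIV - {o1}. g j [^] x j)"
      by (subst finprod_insert) (auto simp: g_o1 finprod_closed)
    finally show ?thesis .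
  qed
  then show ?thesis
    unfolding group_lattice_def relations_def by (auto simp: emb_def[abs_def])
qed

lemma uminus_relations: "x \<in> relations \<Longrightarrow> (\<lambda>i. - x i) \<in> relations"
  by (simp add: relations_def sum_negf \<phi>_uminus)

lemma shift_relations: "x \<in> relations \<Longrightarrow> (\<lambda>i. x (i \<boxplus> h)) \<in> relations"
proof -
  have inj: "inj (\<lambda>i. i \<boxplus> h)" by (rule injI) simp
  then have "range (\<lambda>i. i \<boxplus> h) = UNIV" by (rule finite_UNIV_inj_surj[OF finite])
  then have "(\<Sum>i\<in>UNIV. x (i \<boxplus> h)) = (\<Sum>i\<in>UNIV. x i)"
    using sum.reindex[OF inj, of x] by simp
  then show "x \<in> relations \<Longrightarrow> (\<lambda>i. x (i \<boxplus> h)) \<in> relations"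
    by (simp add: relations_def \<phi>_shift)
qed

text \<open>This is the vector \<open>e_a + e_b - e_c - e_e\<close> of unit vectors. Indices may
  coincide, so differences of two unit vectors are also of this form.\<close>

definition quad :: "'n \<Rightarrow> 'n \<Rightarrow> 'n \<Rightarrow> 'n \<Rightarrow> 'n \<Rightarrow> int" where
  "quad a b c e i = of_bool (a = i) + of_bool (b = i) - of_bool (c = i) - of_bool (e = i)"

lemma \<phi>_of_bool: "\<phi> (\<lambda>i. of_bool (a = i)) = g a"
proof -
  have "\<phi> (\<lambda>i. of_bool (a = i)) = \<phi> (\<lambda>i. if a = i then 1 else 0)" 
    by (rule arg_cong[of _ _ \<phi>]) (rule ext, simp)
  also have "\<dots> = g a [^] (1::int)" by (rule \<phi>_single)
  also have "\<dots> = g a" by (rule int_pow_1) (rule g_closed)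
  finally show ?thesis .
qed

lemma \<phi>_quad: "\<phi> (quad a b c e) \<otimes> (g c \<otimes> g e) = g a \<otimes> g b"
proof -
  have fn: "(\<lambda>i. quad a b c e i + (of_bool (c = i) + of_bool (e = i))) = (\<lambda>i. of_bool (a = i) + of_bool (b = i))"
    by (rule ext) (simp only: quad_def)
  have "\<phi> (quad a b c e) \<otimes> (g c \<otimes> g e) = \<phi> (quad a b c e) \<otimes> \<phi> (\<lambda>i. of_bool (c = i) + of_bool (e = i))"
    by (simp only: \<phi>_add \<phi>_of_bool)
  also have "\<dots> = \<phi> (\<lambda>i. of_bool (a = i) + of_bool (b = i))"
    unfolding fn[symmetric] by (rule \<phi>_add[symmetric])
  also have "\<dots> = g a \<otimes> g b" by (simp only: \<phi>_add \<phi>_of_bool)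
  finally show ?thesis .
qed

lemma sum_quad: "(\<Sum>i\<in>UNIV. quad a b c e i) = 0"
  by (simp add: quad_def sum_subtractf sum.distrib)

lemma quad_relations: "quad a b c e \<in> relations \<longleftrightarrow> a \<boxplus> b = c \<boxplus> e"
proof -
  have "\<phi> (quad a b c e) \<otimes> g (c \<boxplus> e) = g (a \<boxplus> b)"
    by (simp add: g_add \<phi>_quad)
  then have "\<phi> (quad a b c e) = \<one> \<longleftrightarrow> g (a \<boxplus> b) = g (c \<boxplus> e)"
    using r_cancel_one[OF g_closed[of "c \<boxplus> e"] \<phi>_closed[of "quad a b c e"]] by simp
  then show ?thesis by (simp add: relations_def g_eq_iff sum_quad)
qed

text \<open>For \<open>N\<close> the order of the group, \<open>N\<close> times the difference of
  the unit vectors at \<open>a\<close> and \<open>o1\<close> is a relation. These vectors span the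
  whole hyperplane.\<close>

lemma span_lattice: "span L = {z. (\<Sum>i\<in>UNIV. z $ i) = 0}"
proof (rule span_unique)
  show "subspace {z :: real ^ 'n. (\<Sum>i\<in>UNIV. z $ i) = 0}"
    by (auto simp: subspace_def sum.distrib simp flip: sum_distrib_left)
  show "L \<subseteq> {z. (\<Sum>i\<in>UNIV. z $ i) = 0}"
    by (auto simp: lattice_eq relations_def simp flip: of_int_sum)
  fix W :: "(real ^ 'n) set" assume W: "L \<subseteq> W" "subspace W"
  show "{z. (\<Sum>i\<in>UNIV. z $ i) = 0} \<subseteq> W"
  proof
    fix z :: "real ^ 'n" assume "z \<in> {z. (\<Sum>i\<in>UNIV. z $ i) = 0}"
    then have z: "(\<Sum>i\<in>UNIV. z $ i) = 0" by simp
    define N where "N = int (order G)"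
    define m where "m = (\<lambda>a i. (if a = i then N else 0) + (if o1 = i then - N else 0))"
    have N: "N \<noteq> 0" by (simp add: N_def order_eq)
    have pw: "g a [^] N = \<one>" for a
      by (simp add: N_def int_pow_int pow_order_eq_1)
    have "m a \<in> relations" for a
      unfolding m_def relations_def using pw
      by (simp add: sum.distrib \<phi>_add \<phi>_single int_pow_neg g_o1)
    then have "emb (m a) \<in> W" for a using W(1) by (auto simp: lattice_eq)
    then have "(\<Sum>a\<in>UNIV. (z $ a / N) *\<^sub>R emb (m a)) \<in> W"
      using W(2) by (intro subspace_sum subspace_scale)
    also have "(\<Sum>a\<in>UNIV. (z $ a / N) *\<^sub>R emb (m a)) = z"
    proof (rule vec_eq_iff[THEN iffD2], rule allI)
      fix i
      have "z $ a / N * real_of_int (m a i) = (if a = i then z $ a else 0) - (if o1 = i then z $ a else 0)" for a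
        using N by (simp add: m_def)
      then have "(\<Sum>a\<in>UNIV. (z $ a / N) *\<^sub>R emb (m a)) $ i
          = (\<Sum>a\<in>UNIV. (if a = i then z $ a else 0) - (if o1 = i then z $ a else 0))"
        by (simp only: sum_component vector_scaleR_component emb_nth real_scaleR_def)
      \<comment> \<open>At \<open>i = o1\<close> the coefficient is \<open>z $ o1\<close> minus the
        sum of all coordinates, and that sum vanishes.\<close>
      also have "\<dots> = z $ i" using z by (cases "o1 = i") (simp_all add: sum_subtractf)
      finally show "(\<Sum>a\<in>UNIV. (z $ a / N) *\<^sub>R emb (m a)) $ i = z $ i" .
    qed
    finally show "z \<in> W" .
  qed
qed

subsection \<open>Second moments of the minimal vectors\<close>

abbreviation "S \<equiv> min_vectors L"

definition moment :: "'n \<Rightarrow> 'n \<Rightarrow> real" where "moment i j = (\<Sum>x\<in>S. x $ i * x $ j)"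

lemma norm_emb: "norm (emb x) = sqrt (real_of_int (\<Sum>i\<in>UNIV. (x i)\<^sup>2))"
  by (simp add: norm_vec_def L2_set_def)

lemma exists_nonzero:
  assumes "CARD('n) \<ge> 2"
  shows "\<exists>a. a \<noteq> o1"
proof (rule ccontr)
  assume "\<not> (\<exists>a. a \<noteq> o1)"
  then have "UNIV = {o1}" by auto
  then have "CARD('n) = card {o1}" by (rule arg_cong)
  then show False using assms by simp
qed

text \<open>\<open>lattice_min\<close> is a \<open>LEAST\<close> over the reals and is informative
  only if the minimum is attained. Squared norms here are integers, so a minimiser exists once
  \<open>L\<close> has a nonzero vector, and it has one because its span is nonzero.\<close>

lemma minimum_attained:
  assumes "CARD('n) \<ge> 2"
  obtains x where "x \<in> L" "x \<noteq> 0" "lattice_min L = norm x" "\<And>y. y \<in> L \<Longrightarrow> y \<noteq> 0 \<Longrightarrow> norm x \<le> norm y"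
proof -
  obtain a :: 'n where a: "a \<noteq> o1" using exists_nonzero[OF assms] by blast
  have "axis a 1 - axis o1 1 \<in> span L"
    by (simp add: span_lattice axis_def sum_subtractf)
  moreover have "axis a 1 - axis o1 1 \<noteq> (0 :: real ^ 'n)"
    using a by (auto simp: axis_def vec_eq_iff)
  ultimately have "\<not> span L \<subseteq> {0}" by blast
  then have "\<not> L \<subseteq> {0}" using span_mono[of L "{0}"] by auto
  then obtain z where "z \<in> relations" "emb z \<noteq> 0" by (auto simp: lattice_eq)
  then obtain x where x: "x \<in> relations" "emb x \<noteq> 0"
    and least: "\<And>y. y \<in> relations \<Longrightarrow> emb y \<noteq> 0 \<Longrightarrow> nat (\<Sum>i\<in>UNIV. (x i)\<^sup>2) \<le> nat (\<Sum>i\<in>UNIV. (y i)\<^sup>2)"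
    using ex_has_least_nat[of "\<lambda>y. y \<in> relations \<and> emb y \<noteq> 0" z "\<lambda>y. nat (\<Sum>i\<in>UNIV. (y i)\<^sup>2)"]
    by blast
  have le: "norm (emb x) \<le> norm y" if y: "y \<in> L" "y \<noteq> 0" for y
  proof -
    obtain w where w: "y = emb w" "w \<in> relations" using y by (auto simp: lattice_eq)
    then have "nat (\<Sum>i\<in>UNIV. (x i)\<^sup>2) \<le> nat (\<Sum>i\<in>UNIV. (w i)\<^sup>2)" using least y by auto
    then have "(\<Sum>i\<in>UNIV. (x i)\<^sup>2) \<le> (\<Sum>i\<in>UNIV. (w i)\<^sup>2)"
      by (simp add: nat_le_eq_zle sum_nonneg)
    then show ?thesis unfolding w norm_emb by (simp only: real_sqrt_le_iff of_int_le_iff)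
  qed
  have xL: "emb x \<in> L" using x by (simp add: lattice_eq)
  have "lattice_min L = norm (emb x)"
    unfolding lattice_min_def using xL x le by (intro Least_equality) auto
  with that[of "emb x"] xL x le show thesis by blast
qed

text \<open>The coordinates are integers bounded by the norm.\<close>

lemma finite_min_vectors: "finite S"
proof -
  obtain K where K: "real_of_int K \<ge> lattice_min L" using ex_le_of_int by blast
  have "S \<subseteq> emb ` {x. \<forall>i. x i \<in> {-K..K}}"
  proof
    fix y assume "y \<in> S"
    then obtain x where y: "y = emb x" and n: "norm y = lattice_min L"
      by (auto simp: min_vectors_def lattice_eq)
    have "\<bar>x i\<bar> \<le> K" for i
      using component_le_norm_cart[of y i] K n by (simp add: y flip: of_int_abs)
    then have "\<forall>i. x i \<in> {-K..K}" by (auto simp: abs_le_iff minus_le_iff)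
    then show "y \<in> emb ` {x. \<forall>i. x i \<in> {-K..K}}" using y by blast
  qed
  moreover have "finite {x :: 'n \<Rightarrow> int. \<forall>i. x i \<in> {-K..K}}"
    using finite_PiE[of "UNIV :: 'n set" "\<lambda>_. {-K..K}"] by (simp add: PiE_def Pi_def)
  ultimately show ?thesis by (meson finite_imageI finite_subset)
qed

lemma uminus_emb: "- emb x = emb (\<lambda>i. - x i)"
  by (simp add: vec_eq_iff)

lemma uminus_lattice: "x \<in> L \<Longrightarrow> - x \<in> L"
  using uminus_relations by (auto simp: lattice_eq uminus_emb)

lemma uminus_min_vectors: "uminus ` S = S"
proof -
  have "- x \<in> S" if "x \<in> S" for x
    using that by (auto simp: min_vectors_def uminus_lattice)
  then have sub: "uminus ` S \<subseteq> S" by blast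
  from image_mono[OF this, of uminus] have "S \<subseteq> uminus ` S" by (simp add: image_image)
  with sub show ?thesis ..
qed

definition shift :: "'n \<Rightarrow> real ^ 'n \<Rightarrow> real ^ 'n" where "shift h x = (\<chi> i. x $ (i \<boxplus> h))"

lemma bij_add: "bij (\<lambda>i. i \<boxplus> h)"
proof -
  have inj: "inj (\<lambda>i. i \<boxplus> h)" by (rule injI) simp
  moreover have "range (\<lambda>i. i \<boxplus> h) = UNIV" using inj by (rule finite_UNIV_inj_surj[OF finite])
  ultimately show ?thesis by (simp add: bij_def)
qed

lemma shift_min_vectors: "x \<in> S \<Longrightarrow> shift h x \<in> S"
proof -
  assume x: "x \<in> S"
  then obtain w where w: "x = emb w" "w \<in> relations" by (auto simp: min_vectors_def lattice_eq)
  have "shift h x = emb (\<lambda>i. w (i \<boxplus> h))" by (simp add: shift_def w vec_eq_iff)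
  then have "shift h x \<in> L" using shift_relations[OF w(2)] by (simp add: lattice_eq)
  moreover have "norm (shift h x) = norm x"
    using sum.reindex_bij_betw[OF bij_add, of "\<lambda>i. (x $ i)\<^sup>2" h]
    by (simp add: norm_vec_def L2_set_def shift_def)
  ultimately show "shift h x \<in> S" using x by (simp add: min_vectors_def)
qed

text \<open>Translation by \<open>h\<close> permutes the minimal vectors, with translation by
  \<open>neg h\<close> as inverse. Hence a moment depends only on the difference of its
  indices.\<close>

lemma moment_shift: "moment (i \<boxplus> h) (j \<boxplus> h) = moment i j"
  unfolding moment_def
proof (rule sum.reindex_bij_witness[of _ "shift (neg h)" "shift h"])
  fix x
  show "shift (neg h) (shift h x) = x" "shift h (shift (neg h) x) = x"
    by (simp_all add: shift_def vec_eq_iff ix.add.assoc)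
qed (auto simp: shift_min_vectors, simp add: shift_def)

lemma moment_commute: "moment i j = moment j i"
  by (simp add: moment_def mult.commute)

lemma sum_inner_square:
  "(\<Sum>x\<in>S. (x \<bullet> z)\<^sup>2) = (\<Sum>i\<in>UNIV. \<Sum>j\<in>UNIV. moment i j * (z $ i * z $ j))"
proof -
  have "(x \<bullet> z)\<^sup>2 = (\<Sum>i\<in>UNIV. \<Sum>j\<in>UNIV. (x $ i * x $ j) * (z $ i * z $ j))" for x
    by (simp add: inner_vec_def power2_eq_square sum_product mult_ac)
  then have "(\<Sum>x\<in>S. (x \<bullet> z)\<^sup>2)
      = (\<Sum>x\<in>S. \<Sum>i\<in>UNIV. \<Sum>j\<in>UNIV. (x $ i * x $ j) * (z $ i * z $ j))" by simp
  also have "\<dots> = (\<Sum>i\<in>UNIV. \<Sum>j\<in>UNIV. \<Sum>x\<in>S. (x $ i * x $ j) * (z $ i * z $ j))"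
    by (subst sum.swap, rule sum.cong[OF refl], rule sum.swap)
  finally show ?thesis by (simp add: moment_def sum_distrib_right)
qed

text \<open>Rescaling the minimal vectors to the unit sphere only changes the constant, by the
  factor \<open>r\<^sup>2\<close>; the design criterion applies since they form an antipodal
  set.\<close>

lemma strongly_eutactic_iff_quadratic:
  assumes "CARD('n) \<ge> 2"
  shows "strongly_eutactic L \<longleftrightarrow> (\<exists>c. \<forall>z\<in>span L. (\<Sum>x\<in>S. (x \<bullet> z)\<^sup>2) = c * (z \<bullet> z))"
proof -
  obtain v where v: "v \<in> L" "v \<noteq> 0" "lattice_min L = norm v" using minimum_attained[OF assms] by metis
  define r where "r = lattice_min L"
  have r: "r > 0" using v by (simp add: r_def)
  let ?Y = "(\<lambda>x. x /\<^sub>R r) ` S"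
  have inj: "inj_on (\<lambda>x. x /\<^sub>R r) S" using r by (simp add: inj_on_def)
  have "strongly_eutactic L \<longleftrightarrow> (\<exists>c. \<forall>z\<in>span L. (\<Sum>y\<in>?Y. (y \<bullet> z)\<^sup>2) = c * (z \<bullet> z))"
    unfolding strongly_eutactic_def r_def[symmetric]
  proof (rule spherical_design_2_iff)
    show "finite ?Y" using finite_min_vectors by simp
    show "?Y \<noteq> {}" using v by (auto simp: min_vectors_def)
    show "?Y \<subseteq> span L \<inter> sphere 0 1"
    proof
      fix y assume "y \<in> ?Y"
      then obtain x where x: "y = x /\<^sub>R r" "x \<in> L" "norm x = r" by (auto simp: min_vectors_def r_def)
      then show "y \<in> span L \<inter> sphere 0 1" using r by (simp add: span_scale span_base)
    qed
    have "uminus ` ?Y = (\<lambda>x. x /\<^sub>R r) ` (uminus ` S)" by (simp add: image_image)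
    then show "uminus ` ?Y = ?Y" by (simp only: uminus_min_vectors)
  qed simp
  also have "\<dots> \<longleftrightarrow> (\<exists>c. \<forall>z\<in>span L. (\<Sum>x\<in>S. (x \<bullet> z)\<^sup>2) / r\<^sup>2 = c * (z \<bullet> z))"
    by (simp add: sum.reindex[OF inj] power_mult_distrib power_inverse divide_inverse_commute
        flip: sum_distrib_left)
  also have "\<dots> \<longleftrightarrow> (\<exists>c. \<forall>z\<in>span L. (\<Sum>x\<in>S. (x \<bullet> z)\<^sup>2) = c * (z \<bullet> z))"
  proof
    assume "\<exists>c. \<forall>z\<in>span L. (\<Sum>x\<in>S. (x \<bullet> z)\<^sup>2) / r\<^sup>2 = c * (z \<bullet> z)"
    then obtain c where "\<forall>z\<in>span L. (\<Sum>x\<in>S. (x \<bullet> z)\<^sup>2) / r\<^sup>2 = c * (z \<bullet> z)" ..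
    then show "\<exists>c. \<forall>z\<in>span L. (\<Sum>x\<in>S. (x \<bullet> z)\<^sup>2) = c * (z \<bullet> z)"
      using r by (intro exI[of _ "r\<^sup>2 * c"]) (simp add: field_simps)
  next
    assume "\<exists>c. \<forall>z\<in>span L. (\<Sum>x\<in>S. (x \<bullet> z)\<^sup>2) = c * (z \<bullet> z)"
    then obtain c where "\<forall>z\<in>span L. (\<Sum>x\<in>S. (x \<bullet> z)\<^sup>2) = c * (z \<bullet> z)" ..
    then show "\<exists>c. \<forall>z\<in>span L. (\<Sum>x\<in>S. (x \<bullet> z)\<^sup>2) / r\<^sup>2 = c * (z \<bullet> z)"
      using r by (intro exI[of _ "c / r\<^sup>2"]) simp
  qed
  finally show ?thesis .
qed

text \<open>For one direction, the form is tested on differences of two unit vectors, where the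
  diagonal moments agree by translation. For the other, the moment matrix is \<open>\<kappa>\<close>
  times the all-ones matrix plus a multiple of the identity, and the all-ones part vanishes on
  vectors of coordinate sum zero.\<close>

lemma strongly_eutactic_iff_moment:
  assumes "CARD('n) \<ge> 2"
  shows "strongly_eutactic L \<longleftrightarrow> (\<exists>\<kappa>. \<forall>d. d \<noteq> o1 \<longrightarrow> moment d o1 = \<kappa>)"
proof -
  have to_o1: "moment i j = moment (i \<boxminus> j) o1" for i j
    using moment_shift[of "i \<boxminus> j" j o1] by simp
  show ?thesis unfolding strongly_eutactic_iff_quadratic[OF assms]
  proof
    assume "\<exists>c. \<forall>z\<in>span L. (\<Sum>x\<in>S. (x \<bullet> z)\<^sup>2) = c * (z \<bullet> z)"
    then obtain c where c: "\<And>z. z \<in> span L \<Longrightarrow> (\<Sum>x\<in>S. (x \<bullet> z)\<^sup>2) = c * (z \<bullet> z)" by blast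
    have "moment d o1 = moment o1 o1 - c" if d: "d \<noteq> o1" for d
    proof -
      define z :: "real ^ 'n" where "z = axis d 1 - axis o1 1"
      have "z \<in> span L" by (simp add: z_def span_lattice axis_def sum_subtractf)
      moreover have "z \<bullet> z = 2"
        using d by (simp add: z_def inner_diff_left inner_diff_right inner_axis_axis)
      ultimately have "(\<Sum>x\<in>S. (x \<bullet> z)\<^sup>2) = 2 * c" using c by simp
      moreover have "(x \<bullet> z)\<^sup>2 = x $ d * x $ d + x $ o1 * x $ o1 - 2 * (x $ d * x $ o1)" for x
        by (simp add: z_def inner_diff_right inner_axis power2_eq_square algebra_simps)
      then have "(\<Sum>x\<in>S. (x \<bullet> z)\<^sup>2) = moment d d + moment o1 o1 - 2 * moment d o1"
        by (simp add: moment_def sum.distrib sum_subtractf sum_distrib_left)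
      moreover have "moment d d = moment o1 o1" using to_o1[of d d] by simp
      ultimately show ?thesis by simp
    qed
    then show "\<exists>\<kappa>. \<forall>d. d \<noteq> o1 \<longrightarrow> moment d o1 = \<kappa>" by blast
  next
    assume "\<exists>\<kappa>. \<forall>d. d \<noteq> o1 \<longrightarrow> moment d o1 = \<kappa>"
    then obtain \<kappa> where \<kappa>: "\<And>d. d \<noteq> o1 \<Longrightarrow> moment d o1 = \<kappa>" by blast
    define D where "D = moment o1 o1"
    have M: "moment i j = \<kappa> + (if i = j then D - \<kappa> else 0)" for i j
      using to_o1[of i j] \<kappa>[of "i \<boxminus> j"] by (auto simp: D_def)
    have "(\<Sum>x\<in>S. (x \<bullet> z)\<^sup>2) = (D - \<kappa>) * (z \<bullet> z)" if z: "z \<in> span L" for z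
    proof -
      have "(\<Sum>x\<in>S. (x \<bullet> z)\<^sup>2) = (\<Sum>i\<in>UNIV. \<Sum>j\<in>UNIV. \<kappa> * (z $ i * z $ j)
          + (if i = j then (D - \<kappa>) * (z $ i * z $ i) else 0))"
        unfolding sum_inner_square by (intro sum.cong refl) (auto simp: M algebra_simps)
      also have "\<dots> = \<kappa> * (\<Sum>i\<in>UNIV. \<Sum>j\<in>UNIV. z $ i * z $ j) + (D - \<kappa>) * (\<Sum>i\<in>UNIV. z $ i * z $ i)"
        by (simp add: sum.distrib flip: sum_distrib_left)
      also have "(\<Sum>i\<in>UNIV. \<Sum>j\<in>UNIV. z $ i * z $ j) = (\<Sum>i\<in>UNIV. z $ i) * (\<Sum>j\<in>UNIV. z $ j)"
        by (rule sum_product[symmetric])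
      also have "(\<Sum>i\<in>UNIV. z $ i) = 0" using z by (simp add: span_lattice)
      finally show ?thesis by (simp add: inner_vec_def)
    qed
    then show "\<exists>c. \<forall>z\<in>span L. (\<Sum>x\<in>S. (x \<bullet> z)\<^sup>2) = c * (z \<bullet> z)" by blast
  qed
qed

subsection \<open>Counting minimal vectors\<close>

definition quads :: "('n \<Rightarrow> int) set" where
  "quads = {x \<in> relations. (\<Sum>i\<in>UNIV. (x i)\<^sup>2) = 4}"

definition halves :: "'n \<Rightarrow> nat" where "halves d = card {c. c \<boxplus> c = d}"

text \<open>An entry of absolute value at least 2 exhausts the bound 4, so all others vanish and the
  coordinate sum would be that entry.\<close>

lemma abs_le_1_if_sum_squares_le_4:
  fixes x :: "'n \<Rightarrow> int"
  assumes "(\<Sum>i\<in>UNIV. x i) = 0" "(\<Sum>i\<in>UNIV. (x i)\<^sup>2) \<le> 4"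
  shows "\<bar>x i\<bar> \<le> 1"
proof (rule ccontr)
  assume "\<not> \<bar>x i\<bar> \<le> 1"
  then have "2 ^ 2 \<le> \<bar>x i\<bar> ^ 2" by (intro power_mono) auto
  then have four: "4 \<le> (x i)\<^sup>2" by simp
  have "(\<Sum>j\<in>UNIV. (x j)\<^sup>2) = (x i)\<^sup>2 + (\<Sum>j\<in>UNIV - {i}. (x j)\<^sup>2)"
    by (rule sum.remove) auto
  then have "(\<Sum>j\<in>UNIV - {i}. (x j)\<^sup>2) \<le> 0" using assms(2) four by linarith
  moreover have "(\<Sum>j\<in>UNIV - {i}. (x j)\<^sup>2) \<ge> 0" by (rule sum_nonneg) simp
  ultimately have "(\<Sum>j\<in>UNIV - {i}. (x j)\<^sup>2) = 0" by linarith
  then have "\<forall>j\<in>UNIV - {i}. x j = 0" by (subst (asm) sum_nonneg_eq_0_iff) auto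
  then have "(\<Sum>j\<in>UNIV - {i}. x j) = 0" by simp
  moreover have "(\<Sum>j\<in>UNIV. x j) = x i + (\<Sum>j\<in>UNIV - {i}. x j)"
    by (rule sum.remove) auto
  ultimately have "x i = 0" using assms(1) by simp
  with four show False by simp
qed

text \<open>For coordinate sum zero, the two counting formulas together make positive and negative
  entries each number half the squared norm. Short relations thereby become pairs of small index
  sets.\<close>

lemma sign_sets:
  fixes x :: "'n \<Rightarrow> int"
  assumes "\<And>i. \<bar>x i\<bar> \<le> 1"
  shows "x i = of_bool (x i = 1) - of_bool (x i = -1)"
    and "(\<Sum>i\<in>UNIV. x i) = int (card {i. x i = 1}) - int (card {i. x i = -1})"
    and "(\<Sum>i\<in>UNIV. (x i)\<^sup>2) = int (card {i. x i = 1}) + int (card {i. x i = -1})"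
proof -
  have cases: "x i \<in> {-1, 0, 1}" for i using assms[of i] by auto
  then have eq: "x i = of_bool (x i = 1) - of_bool (x i = -1)"
    "(x i)\<^sup>2 = of_bool (x i = 1) + of_bool (x i = -1)" for i
    using cases[of i] by auto
  show "x i = of_bool (x i = 1) - of_bool (x i = -1)" by (rule eq)
  have "(\<Sum>i\<in>UNIV. x i) = (\<Sum>i\<in>UNIV. of_bool (x i = 1) - of_bool (x i = -1))"
    by (rule sum.cong[OF refl eq(1)])
  then show "(\<Sum>i\<in>UNIV. x i) = int (card {i. x i = 1}) - int (card {i. x i = -1})"
    by (simp add: sum_subtractf)
  have "(\<Sum>i\<in>UNIV. (x i)\<^sup>2) = (\<Sum>i\<in>UNIV. of_bool (x i = 1) + of_bool (x i = -1))"
    by (rule sum.cong[OF refl eq(2)])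
  then show "(\<Sum>i\<in>UNIV. (x i)\<^sup>2) = int (card {i. x i = 1}) + int (card {i. x i = -1})"
    by (simp add: sum.distrib)
qed

lemma quads_abs: "x \<in> quads \<Longrightarrow> \<bar>x i\<bar> \<le> 1"
  by (rule abs_le_1_if_sum_squares_le_4) (auto simp: quads_def relations_def)

lemma quads_card:
  assumes "x \<in> quads"
  shows "card {i. x i = 1} = 2" "card {i. x i = -1} = 2"
  using sign_sets(2,3)[of x] quads_abs[OF assms] assms
  by (auto simp: quads_def relations_def)

lemma quad_in_quads:
  assumes "distinct [a, b, c, e]" "a \<boxplus> b = c \<boxplus> e"
  shows "quad a b c e \<in> quads"
proof -
  define X where "X = {a, b, c, e}"
  have "(quad a b c e i)\<^sup>2 = of_bool (i \<in> X)" for i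
    using assms(1) by (auto simp: quad_def X_def)
  then have "(\<Sum>i\<in>UNIV. (quad a b c e i)\<^sup>2) = int (card X)"
    by simp
  also have "card X = 4" using assms(1) by (simp add: X_def)
  finally show ?thesis using assms(2) by (simp add: quads_def quad_relations)
qed

text \<open>Two positions carry 1 and two carry -1. Fixing one of each leaves \<open>b\<close> and
  \<open>e\<close> as the only remaining data, which is the form used for counting.\<close>

lemma quads_cases:
  assumes x: "x \<in> quads" and a: "x a = 1" and c: "x c = -1"
  obtains b e where "x = quad a b c e" "distinct [a, b, c, e]" "a \<boxplus> b = c \<boxplus> e"
proof -
  obtain b where b: "{i. x i = 1} = {a, b}" "a \<noteq> b"
    using card_2_other_element[OF quads_card(1)[OF x]] a by blast
  obtain e where e: "{i. x i = -1} = {c, e}" "c \<noteq> e"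
    using card_2_other_element[OF quads_card(2)[OF x]] c by blast
  have P: "x i = 1 \<longleftrightarrow> i = a \<or> i = b" "x i = -1 \<longleftrightarrow> i = c \<or> i = e" for i
    using b(1) e(1) by (auto simp: set_eq_iff)
  have dist: "distinct [a, b, c, e]"
    using b(2) e(2) P[of a] P[of b] P[of c] P[of e] by auto
  have "x i = quad a b c e i" for i
    by (subst sign_sets(1)[OF quads_abs[OF x]], simp only: P) (use dist in \<open>auto simp: quad_def\<close>)
  then have "x = quad a b c e" by blast
  with dist x that show thesis by (auto simp: quads_def quad_relations)
qed

text \<open>Below squared norm 4 there is at most one entry 1 and equally many entries -1. A
  relation with one of each is a difference of two unit vectors, which would identify two distinct
  group elements.\<close>

lemma small_relation_zero:
  assumes x: "x \<in> relations" and lt: "(\<Sum>i\<in>UNIV. (x i)\<^sup>2) < 4"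
  shows "x = (\<lambda>i. 0)"
proof -
  have abs: "\<bar>x i\<bar> \<le> 1" for i
    using x lt by (intro abs_le_1_if_sum_squares_le_4) (auto simp: relations_def)
  note sg = sign_sets[OF abs]
  have "card {i. x i = 1} = card {i. x i = -1}" "card {i. x i = 1} \<le> 1"
    using sg(2,3) x lt by (auto simp: relations_def)
  moreover have False if "card {i. x i = 1} = 1" "card {i. x i = -1} = 1"
  proof -
    obtain a b where ab: "{i. x i = 1} = {a}" "{i. x i = -1} = {b}"
      using \<open>card {i. x i = 1} = 1\<close> \<open>card {i. x i = -1} = 1\<close> by (auto simp: card_1_singleton_iff)
    have P: "x i = 1 \<longleftrightarrow> i = a" "x i = -1 \<longleftrightarrow> i = b" for i
      using ab by (auto simp: set_eq_iff)
    \<comment> \<open>The two contributions at \<open>o1\<close> cancel, so this is the difference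
      of the unit vectors at \<open>a\<close> and \<open>b\<close>.\<close>
    have "x i = quad a o1 b o1 i" for i
      by (subst sg(1), simp only: P) (auto simp: quad_def)
    then have "x = quad a o1 b o1" by blast
    then have "a = b" using x by (simp add: quad_relations)
    then show False using P[of a] by simp
  qed
  ultimately have "card {i. x i = 1} = 0" "card {i. x i = -1} = 0"
    by (cases "card {i. x i = 1} = 0"; simp)+
  then have "{i. x i = 1} = {}" "{i. x i = -1} = {}" by simp_all
  then show ?thesis using sg(1) by (auto simp: set_eq_iff fun_eq_iff)
qed

text \<open>Order at least 4 leaves room for some \<open>b\<close> outside
  \<open>{o1, d, neg d}\<close>. The relation
  \<open>d \<boxplus> b = o1 \<boxplus> (d \<boxplus> b)\<close> then involves four distinct
  indices.\<close>

lemma quads_nonempty: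
  assumes "CARD('n) \<ge> 4"
  shows "quads \<noteq> {}"
proof -
  obtain d where d: "d \<noteq> o1" using exists_nonzero assms by auto
  have "\<exists>b. b \<notin> {o1, d, neg d}"
  proof (rule ccontr)
    assume "\<not> (\<exists>b. b \<notin> {o1, d, neg d})"
    then have "UNIV = {o1, d, neg d}" by blast
    then have "CARD('n) = card {o1, d, neg d}" by (rule arg_cong)
    also have "\<dots> \<le> 3" by (simp add: card_insert_if)
    finally show False using assms by simp
  qed
  then obtain b where b: "b \<noteq> o1" "b \<noteq> d" "b \<noteq> neg d" by auto
  have "d \<boxplus> b \<noteq> o1" using b(3) ix.minus_unique by blast
  then have "quad d b o1 (d \<boxplus> b) \<in> quads"
    using d b by (intro quad_in_quads) auto
  then show ?thesis by blast
qed

text \<open>A vector from \<open>quads\<close> attains norm 2, and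
  \<open>small_relation_zero\<close> rules out anything shorter.\<close>

lemma min_vectors_eq:
  assumes "CARD('n) \<ge> 4"
  shows "S = emb ` quads"
proof -
  have "CARD('n) \<ge> 2" using assms by simp
  then obtain v where v: "v \<in> L" "v \<noteq> 0" "lattice_min L = norm v"
    and least: "\<And>y. y \<in> L \<Longrightarrow> y \<noteq> 0 \<Longrightarrow> norm v \<le> norm y"
    using minimum_attained by metis
  have n4: "norm (emb x) = 2 \<longleftrightarrow> (\<Sum>i\<in>UNIV. (x i)\<^sup>2) = 4" for x
  proof -
    have "norm (emb x) = 2 \<longleftrightarrow> sqrt (real_of_int (\<Sum>i\<in>UNIV. (x i)\<^sup>2)) = sqrt (real_of_int 4)"
      by (simp only: norm_emb) simp
    then show ?thesis by (simp only: real_sqrt_eq_iff of_int_eq_iff)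
  qed
  obtain x where x: "x \<in> quads" using quads_nonempty[OF assms] by blast
  then have xn: "norm (emb x) = 2" "emb x \<in> L" by (auto simp: n4 quads_def lattice_eq)
  then have "emb x \<noteq> 0" by auto
  then have "norm v \<le> 2" using least[of "emb x"] xn by simp
  moreover obtain w where w: "v = emb w" "w \<in> relations" using v(1) by (auto simp: lattice_eq)
  moreover have "2 \<le> norm v"
  proof -
    have "w \<noteq> (\<lambda>i. 0)" using v(2) w(1) by (auto simp: vec_eq_iff)
    then have "4 \<le> (\<Sum>i\<in>UNIV. (w i)\<^sup>2)" using small_relation_zero[OF w(2)] by linarith
    then have "sqrt (real_of_int 4) \<le> norm v"
      unfolding w norm_emb by (simp only: real_sqrt_le_iff of_int_le_iff)
    then show ?thesis by simp
  qed
  ultimately have "lattice_min L = 2" using v(3) by simp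
  then show ?thesis by (auto simp: min_vectors_def lattice_eq quads_def n4)
qed

lemma finite_quads:
  assumes "CARD('n) \<ge> 4"
  shows "finite quads"
  using finite_min_vectors unfolding min_vectors_eq[OF assms]
  by (rule finite_imageD) (simp add: inj_on_def)

lemma uminus_quads: "x \<in> quads \<Longrightarrow> (\<lambda>i. - x i) \<in> quads"
  by (simp add: quads_def uminus_relations)

section \<open>Counting by signs at two positions\<close>

text \<open>Such a vector is \<open>quad d b o1 (d \<boxplus> b)\<close>, with \<open>b\<close>
  recovered as the second position of value 1. The value \<open>neg d\<close> is excluded because
  the fourth index would fall on \<open>o1\<close>.\<close>

lemma card_opposite_signs:
  assumes d: "d \<noteq> o1"
  shows "card {x \<in> quads. x d = 1 \<and> x o1 = -1} = card (UNIV - {o1, d, neg d})"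
proof -
  have sum: "d \<boxplus> b \<noteq> o1" if "b \<noteq> neg d" for b using that ix.minus_unique by blast
  have "{x \<in> quads. x d = 1 \<and> x o1 = -1} = (\<lambda>b. quad d b o1 (d \<boxplus> b)) ` (UNIV - {o1, d, neg d})"
  proof (intro equalityI subsetI)
    fix x assume "x \<in> {x \<in> quads. x d = 1 \<and> x o1 = -1}"
    then obtain b e where x: "x = quad d b o1 e" "distinct [d, b, o1, e]" "d \<boxplus> b = o1 \<boxplus> e"
      using quads_cases[of x d o1] by blast
    then have "e = d \<boxplus> b" by simp
    moreover have "b \<noteq> neg d" using x by auto
    ultimately show "x \<in> (\<lambda>b. quad d b o1 (d \<boxplus> b)) ` (UNIV - {o1, d, neg d})"
      using x by auto
  next
    fix x assume "x \<in> (\<lambda>b. quad d b o1 (d \<boxplus> b)) ` (UNIV - {o1, d, neg d})"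
    then obtain b where b: "x = quad d b o1 (d \<boxplus> b)" "b \<noteq> o1" "b \<noteq> d" "b \<noteq> neg d" by auto
    have "distinct [d, b, o1, d \<boxplus> b]" using d b sum[of b] by auto
    moreover from this have "x d = 1" "x o1 = -1" unfolding b(1) by (auto simp: quad_def)
    ultimately show "x \<in> {x \<in> quads. x d = 1 \<and> x o1 = -1}"
      unfolding b(1) by (auto intro!: quad_in_quads)
  qed
  moreover have "inj_on (\<lambda>b. quad d b o1 (d \<boxplus> b)) (UNIV - {o1, d, neg d})"
  proof (rule inj_onI)
    fix b b' assume b: "b \<in> UNIV - {o1, d, neg d}" and b': "b' \<in> UNIV - {o1, d, neg d}"
      and eq: "quad d b o1 (d \<boxplus> b) = quad d b' o1 (d \<boxplus> b')"
    have "quad d b o1 (d \<boxplus> b) b = 1" using b d sum[of b] by (auto simp: quad_def)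
    then have "quad d b' o1 (d \<boxplus> b') b = 1" using eq by simp
    then show "b = b'" using b by (auto simp: quad_def of_bool_def split: if_splits)
  qed
  ultimately show ?thesis by (simp add: card_image)
qed

text \<open>Such a vector is \<open>quad d o1 c (d \<boxminus> c)\<close>, and exchanging
  \<open>c\<close> with \<open>d \<boxminus> c\<close> gives the same vector. Counting pairs
  \<open>(x, c)\<close> with \<open>x c = -1\<close> therefore meets each vector twice, while
  projection to \<open>c\<close> is injective. The condition
  \<open>c \<boxplus> c \<noteq> d\<close> keeps the two negative positions apart.\<close>

lemma card_equal_signs:
  assumes n: "CARD('n) \<ge> 4" and d: "d \<noteq> o1"
  shows "2 * card {x \<in> quads. x d = 1 \<and> x o1 = 1} = card {c. c \<noteq> o1 \<and> c \<noteq> d \<and> c \<boxplus> c \<noteq> d}"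
proof -
  let ?T = "{x \<in> quads. x d = 1 \<and> x o1 = 1}"
  let ?C = "{c. c \<noteq> o1 \<and> c \<noteq> d \<and> c \<boxplus> c \<noteq> d}"
  have form: "x = quad d o1 c (d \<boxminus> c) \<and> c \<in> ?C" if x: "x \<in> ?T" and c: "x c = -1" for x c
  proof -
    obtain b e where be: "x = quad d b c e" "distinct [d, b, c, e]" "d \<boxplus> b = c \<boxplus> e"
      using quads_cases[of x d c] x c by blast
    have "x o1 = 1" using x by simp
    then have "b = o1" using be(2) d unfolding be(1) quad_def by (auto simp: of_bool_def split: if_splits)
    then have "e = d \<boxminus> c" using be(3) by (simp add: ix.eq_diff_eq ix.add.commute)
    moreover have "c \<boxplus> c \<noteq> d"
    proof
      assume "c \<boxplus> c = d"
      then have "e = c" using \<open>e = d \<boxminus> c\<close> by auto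
      then show False using be(2) by simp
    qed
    ultimately show ?thesis using be \<open>b = o1\<close> by auto
  qed
  have mem: "quad d o1 c (d \<boxminus> c) \<in> ?T" "quad d o1 c (d \<boxminus> c) c = -1" if c: "c \<in> ?C" for c
  proof -
    have "c \<noteq> d \<boxminus> c" using c by (auto simp: ix.eq_diff_eq)
    moreover have "d \<boxminus> c \<noteq> d" using c ix.diff_add_cancel[of d c] by force
    moreover have ne: "d \<boxminus> c \<noteq> o1" using c by auto
    moreover have "o1 \<noteq> d \<boxminus> c" using ne by (rule not_sym)
    ultimately have dist: "distinct [d, o1, c, d \<boxminus> c]" using c d by auto
    moreover have "d \<boxplus> o1 = c \<boxplus> (d \<boxminus> c)" by (simp add: ix.add.commute[of c])
    ultimately show "quad d o1 c (d \<boxminus> c) \<in> ?T" "quad d o1 c (d \<boxminus> c) c = -1"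
      using quad_in_quads[OF dist] by (auto simp: quad_def)
  qed
  have "(\<Sum>x\<in>?T. card {c. x c = -1}) = card (SIGMA x:?T. {c. x c = -1})"
    using finite_quads[OF n] by simp
  also have "\<dots> = card ?C"
  proof (rule bij_betw_same_card[of snd], rule bij_betw_imageI)
    show "inj_on snd (SIGMA x:?T. {c. x c = -1})"
    proof (rule inj_onI)
      fix p q assume "p \<in> (SIGMA x:?T. {c. x c = -1})" "q \<in> (SIGMA x:?T. {c. x c = -1})"
        and "snd p = snd q"
      then show "p = q"
        using form[of "fst p" "snd p"] form[of "fst q" "snd q"] by (auto simp: prod_eq_iff)
    qed
    show "snd ` (SIGMA x:?T. {c. x c = -1}) = ?C"
    proof (intro equalityI subsetI)
      fix c assume "c \<in> snd ` (SIGMA x:?T. {c. x c = -1})"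
      then obtain x where "x \<in> ?T" "x c = -1" by auto
      then show "c \<in> ?C" using form by blast
    next
      fix c assume c: "c \<in> ?C"
      then show "c \<in> snd ` (SIGMA x:?T. {c. x c = -1})"
        using mem[OF c] by (intro rev_image_eqI[of "(quad d o1 c (d \<boxminus> c), c)"]) auto
    qed
  qed
  finally show ?thesis by (simp add: quads_card)
qed

lemma card_zero_pair:
  assumes "d \<noteq> o1"
  shows "card {o1, d, neg d} = (if d \<boxplus> d = o1 then 2 else 3)"
proof (cases "d \<boxplus> d = o1")
  case True
  then have "neg d = d" by (rule ix.minus_unique)
  then show ?thesis using True assms by simp
next
  case False
  then have "d \<noteq> neg d" using ix.right_minus[of d] by metis
  moreover have "o1 \<noteq> neg d" using assms ix.neg_0_equal_iff_equal[of d] by metis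
  ultimately have "card {o1, d, neg d} = 3" using assms by simp
  then show ?thesis using False by simp
qed

text \<open>Only vectors nonzero at both positions contribute, and negation pairs the sign patterns,
  so the moment is twice the equal-sign count minus twice the opposite-sign count. The case
  distinction comes from \<open>neg d\<close> coinciding with \<open>d\<close>.\<close>

lemma moment_formula:
  assumes n: "CARD('n) \<ge> 4" and d: "d \<noteq> o1"
  shows "moment d o1 = (if d \<boxplus> d = o1 then 2 else 4) - real CARD('n) - real (halves d)"
proof -
  define T where "T = (\<lambda>s t. {x \<in> quads. x d = s \<and> x o1 = t})"
  have fin: "finite quads" using n by (rule finite_quads)
  have neg: "card (T (- s) (- t)) = card (T s t)" for s t
  proof (rule bij_betw_same_card[of "\<lambda>x i. - x i"], rule bij_betw_byWitness[where f' = "\<lambda>x i. - x i"])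
    show "(\<lambda>x i. - x i) ` T (- s) (- t) \<subseteq> T s t" "(\<lambda>x i. - x i) ` T s t \<subseteq> T (- s) (- t)"
      by (auto simp only: T_def mem_Collect_eq uminus_quads minus_minus)
  qed simp_all
  have card: "(\<Sum>x\<in>quads. of_bool (x d = s \<and> x o1 = t)) = real (card (T s t))" for s t
  proof -
    have "T s t = quads \<inter> {x. x d = s \<and> x o1 = t}" by (auto simp: T_def)
    then show ?thesis using fin by simp
  qed
  have "moment d o1 = (\<Sum>x\<in>quads. real_of_int (x d * x o1))"
    unfolding moment_def min_vectors_eq[OF n] by (subst sum.reindex) (auto simp: inj_on_def)
  also have "\<dots> = (\<Sum>x\<in>quads. of_bool (x d = 1 \<and> x o1 = 1) + of_bool (x d = -1 \<and> x o1 = -1)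
      - of_bool (x d = 1 \<and> x o1 = -1) - of_bool (x d = -1 \<and> x o1 = 1))"
  proof (rule sum.cong[OF refl])
    fix x assume "x \<in> quads"
    then have "x d = -1 \<or> x d = 0 \<or> x d = 1" "x o1 = -1 \<or> x o1 = 0 \<or> x o1 = 1"
      using quads_abs[of x d] quads_abs[of x o1] by auto
    then show "real_of_int (x d * x o1) = of_bool (x d = 1 \<and> x o1 = 1) + of_bool (x d = -1 \<and> x o1 = -1)
      - of_bool (x d = 1 \<and> x o1 = -1) - of_bool (x d = -1 \<and> x o1 = 1)"
      by (elim disjE) simp_all
  qed
  also have "\<dots> = real (card (T 1 1)) + card (T (-1) (-1)) - card (T 1 (-1)) - card (T (-1) 1)"
    by (simp only: sum.distrib sum_subtractf card)
  also have "\<dots> = 2 * real (card (T 1 1)) - 2 * real (card (T 1 (-1)))"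
    using neg[of 1 1] neg[of 1 "-1"] by simp
  finally have "moment d o1 = real (2 * card (T 1 1)) - 2 * real (card (T 1 (-1)))" by simp
  also have "2 * card (T 1 1) = card (UNIV - ({o1, d} \<union> {c. c \<boxplus> c = d}))"
    unfolding T_def card_equal_signs[OF n d] by (rule arg_cong[of _ _ card]) auto
  also have "real \<dots> = real CARD('n) - (2 + real (halves d))"
  proof -
    \<comment> \<open>The union is disjoint: if \<open>o1\<close> or \<open>d\<close> were a half of
      \<open>d\<close>, then \<open>d = o1\<close> would follow.\<close>
    have "card ({o1, d} \<union> {c. c \<boxplus> c = d}) = 2 + halves d"
      unfolding halves_def using d by (subst card_Un_disjoint) auto
    then show ?thesis unfolding real_card_Compl by simp
  qed
  also have "real (card (T 1 (-1))) = real CARD('n) - (if d \<boxplus> d = o1 then 2 else 3)"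
  proof -
    have "card {o1, d, neg d} = (if d \<boxplus> d = o1 then 2 else 3)" using d by (rule card_zero_pair)
    then show ?thesis
      unfolding T_def card_opposite_signs[OF d] real_card_Compl by simp
  qed
  finally show ?thesis by simp
qed

section \<open>Fibres of the doubling map and the classification\<close>

lemma double_diff: "(a \<boxminus> b) \<boxplus> (a \<boxminus> b) = (a \<boxplus> a) \<boxminus> (b \<boxplus> b)"
  by (simp only: sub_def ix.minus_add_distrib ix.add_ac)

text \<open>An inhabited fibre of the doubling homomorphism is a translate of its kernel.\<close>

lemma halves_eq:
  assumes "a \<boxplus> a = d"
  shows "halves d = halves o1"
proof -
  have "{c. c \<boxplus> c = d} = (\<lambda>c. c \<boxplus> a) ` {c. c \<boxplus> c = o1}"
  proof (intro equalityI subsetI)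
    fix c assume c: "c \<in> {c. c \<boxplus> c = d}"
    have "(c \<boxminus> a) \<boxplus> (c \<boxminus> a) = (c \<boxplus> c) \<boxminus> (a \<boxplus> a)"
      by (rule double_diff)
    also have "\<dots> = o1" using c assms by simp
    finally show "c \<in> (\<lambda>c. c \<boxplus> a) ` {c. c \<boxplus> c = o1}"
      by (intro rev_image_eqI[of "c \<boxminus> a"]) auto
  next
    fix c assume "c \<in> (\<lambda>c. c \<boxplus> a) ` {c. c \<boxplus> c = o1}"
    then obtain b where b: "c = b \<boxplus> a" "b \<boxplus> b = o1" by auto
    have "c \<boxplus> c = (b \<boxplus> b) \<boxplus> (a \<boxplus> a)"
      unfolding b(1) by (simp only: ix.add_ac)
    then show "c \<in> {c. c \<boxplus> c = d}" using b assms by simp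
  qed
  then show ?thesis
    unfolding halves_def by (simp add: card_image inj_on_def)
qed

lemma double_eq_iff: "i \<boxplus> i = o1 \<longleftrightarrow> g i \<otimes> g i = \<one>"
  by (simp add: g_add g_o1 flip: g_eq_iff)

lemma finite_carrier: "finite (carrier G)"
  using bij bij_betw_finite finite by blast

lemma strongly_eutactic_large:
  assumes n: "CARD('n) \<ge> 4"
  shows "strongly_eutactic L \<longleftrightarrow> odd CARD('n) \<or> (\<forall>i. i \<boxplus> i = o1)"
proof -
  \<comment> \<open>This is the varying part of the moment, not the moment itself:
    \<open>moment d o1\<close> equals 4 minus the order minus \<open>F d\<close>, the summand 2
    accounting for the drop from 4 to 2 in \<open>moment_formula\<close>.\<close>
  define F where "F = (\<lambda>d. halves d + (if d \<boxplus> d = o1 then 2 else 0))"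
  have "strongly_eutactic L \<longleftrightarrow> (\<exists>\<kappa>. \<forall>d. d \<noteq> o1 \<longrightarrow> moment d o1 = \<kappa>)"
    using n by (intro strongly_eutactic_iff_moment) simp
  also have "\<dots> \<longleftrightarrow> (\<exists>K. \<forall>d. d \<noteq> o1 \<longrightarrow> F d = K)"
  proof -
    have M: "moment d o1 = 4 - real CARD('n) - real (F d)" if "d \<noteq> o1" for d
      using moment_formula[OF n that] by (simp add: F_def)
    obtain e where e: "e \<noteq> o1" using exists_nonzero n by auto
    show ?thesis
    proof
      assume "\<exists>\<kappa>. \<forall>d. d \<noteq> o1 \<longrightarrow> moment d o1 = \<kappa>"
      then obtain \<kappa> where \<kappa>: "\<And>d. d \<noteq> o1 \<Longrightarrow> moment d o1 = \<kappa>" by blast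
      have "F d = F e" if "d \<noteq> o1" for d
        using M[OF that] M[OF e] \<kappa>[OF that] \<kappa>[OF e] by simp
      then show "\<exists>K. \<forall>d. d \<noteq> o1 \<longrightarrow> F d = K" by blast
    next
      assume "\<exists>K. \<forall>d. d \<noteq> o1 \<longrightarrow> F d = K"
      then obtain K where "\<And>d. d \<noteq> o1 \<Longrightarrow> F d = K" by blast
      then have "\<forall>d. d \<noteq> o1 \<longrightarrow> moment d o1 = 4 - real CARD('n) - real K" using M by simp
      then show "\<exists>\<kappa>. \<forall>d. d \<noteq> o1 \<longrightarrow> moment d o1 = \<kappa>" by blast
    qed
  qed
  also have "\<dots> \<longleftrightarrow> odd CARD('n) \<or> (\<forall>i. i \<boxplus> i = o1)"
  proof
    assume "odd CARD('n) \<or> (\<forall>i. i \<boxplus> i = o1)"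
    then show "\<exists>K. \<forall>d. d \<noteq> o1 \<longrightarrow> F d = K"
    proof
      assume exp: "\<forall>i. i \<boxplus> i = o1"
      then have "halves d = 0" if "d \<noteq> o1" for d
        using that by (simp add: halves_def)
      then have "\<forall>d. d \<noteq> o1 \<longrightarrow> F d = 2" using exp by (simp add: F_def)
      then show ?thesis by blast
    next
      assume odd: "odd CARD('n)"
      have zero: "c = o1" if "c \<boxplus> c = o1" for c
      proof -
        have "odd (order G)" using odd unfolding order_eq .
        moreover have "g c \<otimes> g c = \<one>" using that by (simp only: double_eq_iff)
        ultimately have "g c = \<one>" by (rule odd_order_involution[OF _ g_closed])
        then have "g c = g o1" by (simp only: g_o1)
        then show ?thesis by (simp only: g_eq_iff)
      qed
      \<comment> \<open>Without elements of order two, doubling is injective and hence bijective on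
        the finite index type, so all its fibres have the same size.\<close>
      have "inj (\<lambda>c. c \<boxplus> c)"
      proof (rule injI)
        fix a b assume ab: "a \<boxplus> a = b \<boxplus> b"
        have "(a \<boxminus> b) \<boxplus> (a \<boxminus> b) = (a \<boxplus> a) \<boxminus> (b \<boxplus> b)"
          by (rule double_diff)
        also have "\<dots> = o1" using ab by simp
        finally have "a \<boxminus> b = o1" by (rule zero)
        then show "a = b" by simp
      qed
      then have "surj (\<lambda>c. c \<boxplus> c)" by (rule finite_UNIV_inj_surj[OF finite])
      then have h: "halves d = halves o1" for d
      proof -
        obtain a where "d = a \<boxplus> a" using \<open>surj (\<lambda>c. c \<boxplus> c)\<close> by (rule surjE)
        then show ?thesis by (intro halves_eq[of a]) simp
      qed
      have "F d = halves o1" if "d \<noteq> o1" for d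
      proof -
        have "d \<boxplus> d \<noteq> o1" using zero[of d] that by blast
        then show ?thesis using h[of d] by (simp add: F_def)
      qed
      then show ?thesis by blast
    qed
  next
    assume "\<exists>K. \<forall>d. d \<noteq> o1 \<longrightarrow> F d = K"
    then obtain K where K: "\<And>d. d \<noteq> o1 \<Longrightarrow> F d = K" by blast
    show "odd CARD('n) \<or> (\<forall>i. i \<boxplus> i = o1)"
    proof (rule ccontr)
      assume "\<not> (odd CARD('n) \<or> (\<forall>i. i \<boxplus> i = o1))"
      then obtain u where even: "even CARD('n)" and u: "u \<boxplus> u \<noteq> o1" by blast
      obtain x where x: "x \<in> carrier G" "x \<noteq> \<one>" "x \<otimes> x = \<one>"
        using exists_involution[OF finite_carrier] even unfolding order_eq by blast
      define d where "d = idx x"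
      have gd: "g d = x" unfolding d_def using x(1) by (rule g_idx)
      have d: "d \<noteq> o1" "d \<boxplus> d = o1"
        unfolding double_eq_iff gd using x(2,3) gd g_o1 by metis+
      \<comment> \<open>Comparing \<open>F w\<close> with \<open>F d\<close>, which carries the
        additional 2, gives \<open>halves w\<close> the value \<open>halves d + 2\<close>; hence
        \<open>w\<close> is a double.\<close>
      have half: "\<exists>a. a \<boxplus> a = w" if w: "w \<boxplus> w \<noteq> o1" for w
      proof -
        have "w \<noteq> o1" using w by auto
        then have "halves w = halves d + 2" using K[of w] K[OF d(1)] w d(2) by (simp add: F_def)
        then have "halves w \<noteq> 0" by simp
        then have "{c. c \<boxplus> c = w} \<noteq> {}" unfolding halves_def by (rule contrapos_nn) simp
        then show ?thesis by blast
      qed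
      \<comment> \<open>Adding \<open>d\<close> does not change the double of \<open>u\<close>, so
        \<open>u \<boxplus> d\<close> is a double too, and \<open>d\<close> is the double of a
        difference.\<close>
      have "(u \<boxplus> d) \<boxplus> (u \<boxplus> d) = (u \<boxplus> u) \<boxplus> (d \<boxplus> d)" by (simp only: ix.add_ac)
      then have "(u \<boxplus> d) \<boxplus> (u \<boxplus> d) \<noteq> o1" using u d by simp
      from half[OF this] obtain b where b: "b \<boxplus> b = u \<boxplus> d" by blast
      obtain a where a: "a \<boxplus> a = u" using half[OF u] by blast
      have "(b \<boxminus> a) \<boxplus> (b \<boxminus> a) = (b \<boxplus> b) \<boxminus> (a \<boxplus> a)"
        by (rule double_diff)
      also have "\<dots> = d" by (simp add: a b)
      finally have "halves d = halves o1" by (rule halves_eq)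
      \<comment> \<open>Both \<open>d\<close> and \<open>u\<close> are doubles and so have equally
        many halves, yet \<open>F d\<close> exceeds \<open>F u\<close> by 2.\<close>
      then have "halves d = halves u" using halves_eq[OF a] by simp
      moreover have "u \<noteq> o1" using u by auto
      ultimately show False using K[of u] K[OF d(1)] u d(2) by (simp add: F_def)
    qed
  qed
  finally show ?thesis .
qed

text \<open>Translation and symmetry make the moments at \<open>d\<close> and \<open>neg d\<close>
  equal. Two nonzero elements neither equal nor opposite would have a fourth element as their sum,
  so among at most three elements all nonzero ones give the same moment.\<close>

lemma strongly_eutactic_small:
  assumes "CARD('n) \<ge> 2" "CARD('n) \<le> 3"
  shows "strongly_eutactic L"
proof -
  have opp: "d' = d \<or> d' = neg d" if d: "d \<noteq> o1" "d' \<noteq> o1" for d d'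
  proof (rule ccontr)
    assume "\<not> (d' = d \<or> d' = neg d)"
    then have ne: "d' \<noteq> d" "d' \<noteq> neg d" by auto
    have "card {o1, d, d'} = 3" using d ne by auto
    then have "{o1, d, d'} = UNIV"
      using assms(2) card_seteq[of UNIV "{o1, d, d'}"] by simp
    then have "d \<boxplus> d' \<in> {o1, d, d'}" by blast
    moreover have "d \<boxplus> d' \<noteq> o1" using ne(2) ix.minus_unique[of d d'] by metis
    ultimately show False using d by auto
  qed
  have "moment (neg d) o1 = moment d o1" for d
    using moment_shift[of "neg d" d o1] by (simp add: moment_commute)
  then have const: "moment d' o1 = moment d o1" if "d \<noteq> o1" "d' \<noteq> o1" for d d'
    using opp[OF that] by auto
  obtain e where "e \<noteq> o1" using exists_nonzero[OF assms(1)] by blast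
  then have "\<forall>d. d \<noteq> o1 \<longrightarrow> moment d o1 = moment e o1" using const by blast
  then show ?thesis unfolding strongly_eutactic_iff_moment[OF assms(1)] by blast
qed

text \<open>Order two forces exponent two by Lagrange, and three is odd.\<close>

lemma small_dichotomy:
  assumes "CARD('n) \<ge> 2" "CARD('n) \<le> 3"
  shows "odd CARD('n) \<or> (\<forall>i. i \<boxplus> i = o1)"
proof (cases "CARD('n) = 2")
  case True
  have "g i \<otimes> g i = \<one>" for i
    using pow_order_eq_1[of "g i"] True by (simp add: order_eq numeral_2_eq_2)
  then show ?thesis by (simp add: double_eq_iff)
next
  case False
  then have "CARD('n) = 3" using assms by simp
  then show ?thesis by simp
qed

end

theorem theorem1p1:
  fixes G :: "('a, 'c) monoid_scheme"
    and g :: "'n::finite \<Rightarrow> 'a"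
    and o1 :: 'n
  assumes "comm_group G"
    and "finite (carrier G)"
    and "order G \<ge> 2"
    and "bij_betw g UNIV (carrier G)"
    and "g o1 = \<one>\<^bsub>G\<^esub>"
  shows "strongly_eutactic (group_lattice G g o1) \<longleftrightarrow>
           odd (order G) \<or>
           (\<exists>\<nu>\<ge>1. G \<cong> product_group {..<\<nu>::nat} (\<lambda>_. integer_mod_group 2))"
proof -
  interpret comm_group G by (rule assms(1))
  interpret indexed_group G g o1
    by unfold_locales (rule assms(4), rule assms(5))
  have "carrier G = range g" using assms(4) by (simp add: bij_betw_def)
  then have exp: "(\<forall>x\<in>carrier G. x \<otimes>\<^bsub>G\<^esub> x = \<one>\<^bsub>G\<^esub>) \<longleftrightarrow> (\<forall>i. i \<boxplus> i = o1)"
    unfolding double_eq_iff by simp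
  have two: "CARD('n) \<ge> 2" using assms(3) by (simp only: order_eq)
  have "strongly_eutactic L \<longleftrightarrow> odd CARD('n) \<or> (\<forall>i. i \<boxplus> i = o1)"
  \<comment> \<open>Minimal vectors with four distinct indices exist from order 4 on; for orders 2
    and 3 both sides of the equivalence hold.\<close>
  proof (cases "CARD('n) \<ge> 4")
    case True
    then show ?thesis by (rule strongly_eutactic_large)
  next
    case False
    then have "CARD('n) \<le> 3" by simp
    with two show ?thesis using strongly_eutactic_small small_dichotomy by blast
  qed
  then show ?thesis
    unfolding elementary_two_group_iff[OF assms(2,3)] exp order_eq .
qed

end
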